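(* Let $R$ be a ring with identity, let ${}_RM$ be a finitely generated semisimple left $R$-module and let $\varphi\in\mathrm{End}_R(M)$ be nilpotent. Let $X=\{x_{\gamma,i}\mid 1\le\gamma\le m,\ 1\le i\le k_\gamma\}$ be a nilpotent Jordan normal base of ${}_RM$ with respect to $\varphi$, with $k_1\ge k_2\ge\cdots\ge k_m\ge 1$. Then the map $\Lambda:\mathcal{M}(X)^{\mathrm{op}}\to\mathrm{Cen}(\varphi)$ induces the following isomorphisms of $Z(R)$-algebras: $$\mathcal{M}_0(X)^{\mathrm{op}}/\ker(\Lambda)\cong\mathrm{Cen}_0(\varphi)\quad\text{and}\quad \mathcal{M}(X)^{\mathrm{op}}/\mathcal{M}_0(X)\cong\mathrm{Cen}(\varphi)/\mathrm{Cen}_0(\varphi).$$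
   Context: $Z(R)$ is the centre of $R$; $R[z]$ is the polynomial ring in an indeterminate $z$ commuting with $R$; $S^{\mathrm{op}}$ is the opposite ring of $S$; algebras need not have an identity. Centralizers: $\mathrm{Cen}(\varphi)=\{\psi\in\mathrm{End}_R(M)\mid\psi\circ\varphi=\varphi\circ\psi\}$, a $Z(R)$-subalgebra of $\mathrm{End}_R(M)$, and $\mathrm{Cen}_0(\varphi)=\{\psi\in\mathrm{End}_R(M)\mid\psi\circ\varphi=\varphi\circ\psi=0\}$, an ideal of $\mathrm{Cen}(\varphi)$. Nilpotent Jordan normal base: a subset $X=\{x_{\gamma,i}\mid\gamma\in\Gamma,\ 1\le i\le k_\gamma\}\subseteq M$ such that each $Rx_{\gamma,i}$ is a simple submodule, $M=\bigoplus_{\gamma\in\Gamma,\,1\le i\le k_\gamma}Rx_{\gamma,i}$ (direct sum), $\varphi(x_{\gamma,i})=x_{\gamma,i+1}$ for $1\le i<k_\gamma$, $\varphi(x_{\gamma,k_\gamma})=0$, and $\{k_\gamma\}$ is bounded. Such a base exists for any nilpotent endomorphism of a semisimple module; here $M$ is finitely generated, $\Gamma=\{1,\dots,m\}$ with $m=\dim_R(\ker\varphi)$ (the number of simple summands of $\ker\varphi$). The map $\Phi$: elements $\mathbf{f}=(f_\gamma(z))_{\gamma\in\Gamma}$ of $(R[z])^\Gamma$ are regarded as $1\times m$ row vectors over $R[z]$. If $f_\gamma(z)=a_{\gamma,1}+a_{\gamma,2}z+\cdots+a_{\gamma,n_\gamma+1}z^{n_\gamma}$ (with $a_{\gamma,i}=0$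 for $i>n_\gamma+1$), then $\Phi:(R[z])^\Gamma\to M$ is given by $\Phi(\mathbf{f})=\sum_{\gamma\in\Gamma,\,1\le i\le k_\gamma}a_{\gamma,i}x_{\gamma,i}$. It is known that $\Phi$ is a surjective left $R[z]$-homomorphism, where $z$ acts on $M$ as $\varphi$. Define $\mathcal{M}(X)=\{\mathbf{P}\in\mathrm{M}_m(R[z])\mid\mathbf{f}\mathbf{P}\in\ker(\Phi)\text{ for all }\mathbf{f}\in\ker(\Phi)\}$, a $Z(R)$-subalgebra of $\mathrm{M}_m(R[z])$, and $\mathcal{M}_0(X)=\{\mathbf{P}\in\mathcal{M}(X)\mid z\mathbf{f}\mathbf{P}\in\ker(\Phi)\text{ for all }\mathbf{f}\in(R[z])^\Gamma\}$. The map $\Lambda$: for $\mathbf{P}\in\mathcal{M}(X)$, $\Lambda(\mathbf{P})=\psi_{\mathbf{P}}\in\mathrm{Cen}(\varphi)$ is the endomorphism determined by $\psi_{\mathbf{P}}(\Phi(\mathbf{f}))=\Phi(\mathbf{f}\mathbf{P})$ for all $\mathbf{f}\in(R[z])^\Gamma$. It is known that $\Lambda:\mathcal{M}(X)^{\mathrm{op}}\to\mathrm{Cen}(\varphi)$ is a well-defined surjective homomorphism of $Z(R)$-algebras. *)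

theory Defs
  imports
    "Jordan_Normal_Form.Matrix"
    "HOL-Algebra.QuotRing"
    "HOL-Library.Poly_Mapping"
begin

section \<open>Left modules over a ring with identity\<close>

text \<open>
  The sort \<open>{ring, monoid_mult}\<close> is a possibly noncommutative ring with identity.  Unlike
  \<^class>\<open>ring_1\<close> it does not exclude the zero ring.  The library locale for modules over type classes
  requires a commutative ring.
\<close>

locale left_module =
  fixes scale :: "'r::{ring,monoid_mult} \<Rightarrow> 'm::ab_group_add \<Rightarrow> 'm"
  assumes scale_right_distrib: "scale r (x + y) = scale r x + scale r y"
    and scale_left_distrib: "scale (r + s) x = scale r x + scale s x"
    and scale_scale: "scale r (scale s x) = scale (r * s) x"
    and scale_one: "scale 1 x = x"

definition left_submodule :: "('r \<Rightarrow> 'm::ab_group_add \<Rightarrow> 'm) \<Rightarrow> 'm set \<Rightarrow> bool" where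
  "left_submodule scale N \<longleftrightarrow>
     0 \<in> N \<and> (\<forall>x\<in>N. \<forall>y\<in>N. x + y \<in> N) \<and> (\<forall>r. \<forall>x\<in>N. scale r x \<in> N)"

definition simple_submodule :: "('r \<Rightarrow> 'm::ab_group_add \<Rightarrow> 'm) \<Rightarrow> 'm set \<Rightarrow> bool" where
  "simple_submodule scale N \<longleftrightarrow>
     left_submodule scale N \<and> N \<noteq> {0} \<and>
     (\<forall>L. left_submodule scale L \<and> L \<subseteq> N \<longrightarrow> L = {0} \<or> L = N)"

definition submodule_generated :: "('r \<Rightarrow> 'm::ab_group_add \<Rightarrow> 'm) \<Rightarrow> 'm set \<Rightarrow> 'm set" where
  "submodule_generated scale S = left_submodule scale hull S"

definition finitely_generated_module :: "('r \<Rightarrow> 'm::ab_group_add \<Rightarrow> 'm) \<Rightarrow> bool" where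
  "finitely_generated_module scale \<longleftrightarrow> (\<exists>S. finite S \<and> submodule_generated scale S = UNIV)"

definition semisimple_module :: "('r \<Rightarrow> 'm::ab_group_add \<Rightarrow> 'm) \<Rightarrow> bool" where
  "semisimple_module scale \<longleftrightarrow>
     submodule_generated scale (\<Union>{N. simple_submodule scale N}) = UNIV"

definition internal_direct_sum ::
    "('r \<Rightarrow> 'm::ab_group_add \<Rightarrow> 'm) \<Rightarrow> 'i set \<Rightarrow> ('i \<Rightarrow> 'm set) \<Rightarrow> bool" where
  "internal_direct_sum scale I N \<longleftrightarrow>
     (\<forall>i\<in>I. left_submodule scale (N i)) \<and>
     submodule_generated scale (\<Union>i\<in>I. N i) = UNIV \<and>
     (\<forall>i\<in>I. N i \<inter> submodule_generated scale (\<Union>j\<in>I - {i}. N j) = {0})"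

definition module_endomorphism :: "('r \<Rightarrow> 'm::ab_group_add \<Rightarrow> 'm) \<Rightarrow> ('m \<Rightarrow> 'm) \<Rightarrow> bool" where
  "module_endomorphism scale \<psi> \<longleftrightarrow>
     (\<forall>x y. \<psi> (x + y) = \<psi> x + \<psi> y) \<and> (\<forall>r x. \<psi> (scale r x) = scale r (\<psi> x))"

definition nilpotent_map :: "('m::zero \<Rightarrow> 'm) \<Rightarrow> bool" where
  "nilpotent_map \<phi> \<longleftrightarrow> (\<exists>n. \<phi> ^^ n = (\<lambda>_. 0))"

text \<open>
  Positions in a block start at 0, so \<open>x \<gamma> i\<close> for \<open>i < k \<gamma>\<close> is the element usually written
  \<open>x\<close> with indices \<open>\<gamma>, i + 1\<close>.
\<close>

definition nilpotent_jordan_normal_base ::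
    "('r \<Rightarrow> 'm::ab_group_add \<Rightarrow> 'm) \<Rightarrow> ('m \<Rightarrow> 'm) \<Rightarrow> 'g set \<Rightarrow> ('g \<Rightarrow> nat) \<Rightarrow> ('g \<Rightarrow> nat \<Rightarrow> 'm) \<Rightarrow> bool"
  where
  "nilpotent_jordan_normal_base scale \<phi> \<Gamma> k x \<longleftrightarrow>
     (\<forall>\<gamma>\<in>\<Gamma>. 1 \<le> k \<gamma>) \<and>
     (\<forall>\<gamma>\<in>\<Gamma>. \<forall>i<k \<gamma>. simple_submodule scale (range (\<lambda>r. scale r (x \<gamma> i)))) \<and>
     internal_direct_sum scale (SIGMA \<gamma>:\<Gamma>. {..<k \<gamma>}) (\<lambda>(\<gamma>, i). range (\<lambda>r. scale r (x \<gamma> i))) \<and>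
     (\<forall>\<gamma>\<in>\<Gamma>. \<forall>i. Suc i < k \<gamma> \<longrightarrow> \<phi> (x \<gamma> i) = x \<gamma> (Suc i)) \<and>
     (\<forall>\<gamma>\<in>\<Gamma>. \<phi> (x \<gamma> (k \<gamma> - 1)) = 0) \<and>
     (\<exists>n. \<forall>\<gamma>\<in>\<Gamma>. k \<gamma> \<le> n)"


section \<open>Algebras that need not have an identity\<close>

text \<open>
  The records of \<^theory>\<open>HOL-Algebra.Module\<close> are used; their field \<open>one\<close> plays no role in what follows.
\<close>

locale nonunital_algebra = Module.module K A for K (structure) and A (structure) +
  assumes mult_closed: "\<lbrakk>x \<in> carrier A; y \<in> carrier A\<rbrakk> \<Longrightarrow> x \<otimes>\<^bsub>A\<^esub> y \<in> carrier A"
    and mult_assoc: "\<lbrakk>x \<in> carrier A; y \<in> carrier A; z \<in> carrier A\<rbrakk> \<Longrightarrow>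
          (x \<otimes>\<^bsub>A\<^esub> y) \<otimes>\<^bsub>A\<^esub> z = x \<otimes>\<^bsub>A\<^esub> (y \<otimes>\<^bsub>A\<^esub> z)"
    and mult_l_distr: "\<lbrakk>x \<in> carrier A; y \<in> carrier A; z \<in> carrier A\<rbrakk> \<Longrightarrow>
          (x \<oplus>\<^bsub>A\<^esub> y) \<otimes>\<^bsub>A\<^esub> z = x \<otimes>\<^bsub>A\<^esub> z \<oplus>\<^bsub>A\<^esub> y \<otimes>\<^bsub>A\<^esub> z"
    and mult_r_distr: "\<lbrakk>x \<in> carrier A; y \<in> carrier A; z \<in> carrier A\<rbrakk> \<Longrightarrow>
          x \<otimes>\<^bsub>A\<^esub> (y \<oplus>\<^bsub>A\<^esub> z) = x \<otimes>\<^bsub>A\<^esub> y \<oplus>\<^bsub>A\<^esub> x \<otimes>\<^bsub>A\<^esub> z"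
    and smult_mult_left: "\<lbrakk>c \<in> carrier K; x \<in> carrier A; y \<in> carrier A\<rbrakk> \<Longrightarrow>
          (c \<odot>\<^bsub>A\<^esub> x) \<otimes>\<^bsub>A\<^esub> y = c \<odot>\<^bsub>A\<^esub> (x \<otimes>\<^bsub>A\<^esub> y)"
    and smult_mult_right: "\<lbrakk>c \<in> carrier K; x \<in> carrier A; y \<in> carrier A\<rbrakk> \<Longrightarrow>
          x \<otimes>\<^bsub>A\<^esub> (c \<odot>\<^bsub>A\<^esub> y) = c \<odot>\<^bsub>A\<^esub> (x \<otimes>\<^bsub>A\<^esub> y)"

definition algebra_iso ::
    "('k, 'l) ring_scheme \<Rightarrow> ('k, 'a, 'c) module_scheme \<Rightarrow> ('k, 'b, 'd) module_scheme \<Rightarrow> ('a \<Rightarrow> 'b) \<Rightarrow> bool"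
  where
  "algebra_iso K A B h \<longleftrightarrow>
     nonunital_algebra K A \<and> nonunital_algebra K B \<and>
     bij_betw h (carrier A) (carrier B) \<and>
     (\<forall>x\<in>carrier A. \<forall>y\<in>carrier A. h (x \<oplus>\<^bsub>A\<^esub> y) = h x \<oplus>\<^bsub>B\<^esub> h y) \<and>
     (\<forall>x\<in>carrier A. \<forall>y\<in>carrier A. h (x \<otimes>\<^bsub>A\<^esub> y) = h x \<otimes>\<^bsub>B\<^esub> h y) \<and>
     (\<forall>c\<in>carrier K. \<forall>x\<in>carrier A. h (c \<odot>\<^bsub>A\<^esub> x) = c \<odot>\<^bsub>B\<^esub> h x)"

definition algebra_ideal ::
    "('k, 'l) ring_scheme \<Rightarrow> 'a set \<Rightarrow> ('k, 'a, 'c) module_scheme \<Rightarrow> bool" where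
  "algebra_ideal K I A \<longleftrightarrow>
     additive_subgroup I A \<and>
     (\<forall>x\<in>I. \<forall>a\<in>carrier A. x \<otimes>\<^bsub>A\<^esub> a \<in> I \<and> a \<otimes>\<^bsub>A\<^esub> x \<in> I) \<and>
     (\<forall>c\<in>carrier K. \<forall>x\<in>I. c \<odot>\<^bsub>A\<^esub> x \<in> I)"

definition opposite_algebra :: "('k, 'a, 'c) module_scheme \<Rightarrow> ('k, 'a, 'c) module_scheme" where
  "opposite_algebra A = A\<lparr>mult := \<lambda>x y. y \<otimes>\<^bsub>A\<^esub> x\<rparr>"

definition quotient_algebra :: "('k, 'a, 'c) module_scheme \<Rightarrow> 'a set \<Rightarrow> ('k, 'a set) module" where
  "quotient_algebra A I =
     \<lparr>carrier = a_rcosets\<^bsub>A\<^esub> I, mult = rcoset_mult A I, one = I +>\<^bsub>A\<^esub> \<one>\<^bsub>A\<^esub>,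
      zero = I, add = set_add A, smult = (\<lambda>c S. \<Union>s\<in>S. I +>\<^bsub>A\<^esub> (c \<odot>\<^bsub>A\<^esub> s))\<rparr>"

definition centre_ring :: "'r::{ring,monoid_mult} ring" where
  "centre_ring =
     \<lparr>carrier = {c. \<forall>r. c * r = r * c}, mult = (*), one = 1, zero = 0, add = (+)\<rparr>"


section \<open>Centralizers\<close>

definition End_algebra :: "('r \<Rightarrow> 'm::ab_group_add \<Rightarrow> 'm) \<Rightarrow> ('r, 'm \<Rightarrow> 'm) module" where
  "End_algebra scale =
     \<lparr>carrier = {\<psi>. module_endomorphism scale \<psi>}, mult = (\<circ>), one = id,
      zero = (\<lambda>_. 0), add = (\<lambda>\<psi> \<chi> v. \<psi> v + \<chi> v), smult = (\<lambda>c \<psi> v. scale c (\<psi> v))\<rparr>"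

definition Cen :: "('r \<Rightarrow> 'm::ab_group_add \<Rightarrow> 'm) \<Rightarrow> ('m \<Rightarrow> 'm) \<Rightarrow> ('m \<Rightarrow> 'm) set" where
  "Cen scale \<phi> = {\<psi>. module_endomorphism scale \<psi> \<and> \<psi> \<circ> \<phi> = \<phi> \<circ> \<psi>}"

definition Cen0 :: "('r \<Rightarrow> 'm::ab_group_add \<Rightarrow> 'm) \<Rightarrow> ('m \<Rightarrow> 'm) \<Rightarrow> ('m \<Rightarrow> 'm) set" where
  "Cen0 scale \<phi> =
     {\<psi>. module_endomorphism scale \<psi> \<and> \<psi> \<circ> \<phi> = (\<lambda>_. 0) \<and> \<phi> \<circ> \<psi> = (\<lambda>_. 0)}"

definition Cen_algebra :: "('r \<Rightarrow> 'm::ab_group_add \<Rightarrow> 'm) \<Rightarrow> ('m \<Rightarrow> 'm) \<Rightarrow> ('r, 'm \<Rightarrow> 'm) module" where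
  "Cen_algebra scale \<phi> = (End_algebra scale)\<lparr>carrier := Cen scale \<phi>\<rparr>"

definition Cen0_algebra :: "('r \<Rightarrow> 'm::ab_group_add \<Rightarrow> 'm) \<Rightarrow> ('m \<Rightarrow> 'm) \<Rightarrow> ('r, 'm \<Rightarrow> 'm) module" where
  "Cen0_algebra scale \<phi> = (End_algebra scale)\<lparr>carrier := Cen0 scale \<phi>\<rparr>"


section \<open>Matrices over the polynomial ring\<close>

text \<open>
  Since the coefficients need not commute, \<open>R[z]\<close> is the monoid ring of the additive monoid \<open>nat\<close>,
  with convolution as multiplication: \<open>lookup p i\<close> is the coefficient at the \<open>i\<close>-th power of \<open>z\<close> and
  \<open>single 0 r\<close> is the constant polynomial \<open>r\<close>.
\<close>

type_synonym 'r ncpoly = "nat \<Rightarrow>\<^sub>0 'r"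

definition polyvar :: "'r::{ring,monoid_mult} ncpoly" where
  "polyvar = Poly_Mapping.single 1 1"

definition matrix_algebra :: "nat \<Rightarrow> ('r::{ring,monoid_mult}, 'r ncpoly mat) module" where
  "matrix_algebra m =
     \<lparr>carrier = carrier_mat m m, mult = (*),
      one = mat m m (\<lambda>(i, j). if i = j then Poly_Mapping.single 0 1 else 0),
      zero = 0\<^sub>m m m, add = (+), smult = (\<lambda>c P. Poly_Mapping.single 0 c \<cdot>\<^sub>m P)\<rparr>"

text \<open>
  The blocks are indexed by \<open>{..<m}\<close>.  Elements of the \<open>m\<close>-fold power of \<open>R[z]\<close> are row vectors, i.e.
  members of \<^term>\<open>carrier_mat 1 m\<close>.
\<close>

definition Phi ::
    "('r::{ring,monoid_mult} \<Rightarrow> 'm::ab_group_add \<Rightarrow> 'm) \<Rightarrow> nat \<Rightarrow> (nat \<Rightarrow> nat) \<Rightarrow> (nat \<Rightarrow> nat \<Rightarrow> 'm) \<Rightarrow>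
     'r ncpoly mat \<Rightarrow> 'm" where
  "Phi scale m k x f = (\<Sum>\<gamma><m. \<Sum>i<k \<gamma>. scale (Poly_Mapping.lookup (f $$ (0, \<gamma>)) i) (x \<gamma> i))"

definition ker_Phi ::
    "('r::{ring,monoid_mult} \<Rightarrow> 'm::ab_group_add \<Rightarrow> 'm) \<Rightarrow> nat \<Rightarrow> (nat \<Rightarrow> nat) \<Rightarrow> (nat \<Rightarrow> nat \<Rightarrow> 'm) \<Rightarrow>
     'r ncpoly mat set" where
  "ker_Phi scale m k x = {f \<in> carrier_mat 1 m. Phi scale m k x f = 0}"

definition MX ::
    "('r::{ring,monoid_mult} \<Rightarrow> 'm::ab_group_add \<Rightarrow> 'm) \<Rightarrow> nat \<Rightarrow> (nat \<Rightarrow> nat) \<Rightarrow> (nat \<Rightarrow> nat \<Rightarrow> 'm) \<Rightarrow>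
     'r ncpoly mat set" where
  "MX scale m k x =
     {P \<in> carrier_mat m m. \<forall>f\<in>ker_Phi scale m k x. f * P \<in> ker_Phi scale m k x}"

definition M0X ::
    "('r::{ring,monoid_mult} \<Rightarrow> 'm::ab_group_add \<Rightarrow> 'm) \<Rightarrow> nat \<Rightarrow> (nat \<Rightarrow> nat) \<Rightarrow> (nat \<Rightarrow> nat \<Rightarrow> 'm) \<Rightarrow>
     'r ncpoly mat set" where
  "M0X scale m k x =
     {P \<in> MX scale m k x. \<forall>f\<in>carrier_mat 1 m. polyvar \<cdot>\<^sub>m (f * P) \<in> ker_Phi scale m k x}"

definition MX_algebra ::
    "('r::{ring,monoid_mult} \<Rightarrow> 'm::ab_group_add \<Rightarrow> 'm) \<Rightarrow> nat \<Rightarrow> (nat \<Rightarrow> nat) \<Rightarrow> (nat \<Rightarrow> nat \<Rightarrow> 'm) \<Rightarrow>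
     ('r, 'r ncpoly mat) module" where
  "MX_algebra scale m k x = (matrix_algebra m)\<lparr>carrier := MX scale m k x\<rparr>"

definition M0X_algebra ::
    "('r::{ring,monoid_mult} \<Rightarrow> 'm::ab_group_add \<Rightarrow> 'm) \<Rightarrow> nat \<Rightarrow> (nat \<Rightarrow> nat) \<Rightarrow> (nat \<Rightarrow> nat \<Rightarrow> 'm) \<Rightarrow>
     ('r, 'r ncpoly mat) module" where
  "M0X_algebra scale m k x = (matrix_algebra m)\<lparr>carrier := M0X scale m k x\<rparr>"

text \<open>
  The description determines a unique endomorphism for \<open>P \<in> MX scale m k x\<close>, because \<open>\<Phi>\<close> is
  surjective; the value at other matrices is irrelevant.
\<close>

definition Lambda ::
    "('r::{ring,monoid_mult} \<Rightarrow> 'm::ab_group_add \<Rightarrow> 'm) \<Rightarrow> ('m \<Rightarrow> 'm) \<Rightarrow>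
     nat \<Rightarrow> (nat \<Rightarrow> nat) \<Rightarrow> (nat \<Rightarrow> nat \<Rightarrow> 'm) \<Rightarrow> 'r ncpoly mat \<Rightarrow> ('m \<Rightarrow> 'm)" where
  "Lambda scale \<phi> m k x P =
     (THE \<psi>. \<psi> \<in> Cen scale \<phi> \<and>
        (\<forall>f\<in>carrier_mat 1 m. \<psi> (Phi scale m k x f) = Phi scale m k x (f * P)))"

definition ker_Lambda ::
    "('r::{ring,monoid_mult} \<Rightarrow> 'm::ab_group_add \<Rightarrow> 'm) \<Rightarrow> ('m \<Rightarrow> 'm) \<Rightarrow>
     nat \<Rightarrow> (nat \<Rightarrow> nat) \<Rightarrow> (nat \<Rightarrow> nat \<Rightarrow> 'm) \<Rightarrow> 'r ncpoly mat set" where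
  "ker_Lambda scale \<phi> m k x =
     a_kernel (opposite_algebra (MX_algebra scale m k x)) (Cen_algebra scale \<phi>) (Lambda scale \<phi> m k x)"

end

theory Submission
  imports Defs
begin

text \<open>
  Both isomorphisms come from the first isomorphism theorem for algebras without identity, applied
  to \<open>\<Lambda>\<close>.  Three facts about \<open>\<Lambda>\<close> are needed.

  \<^item> \<open>\<Lambda>\<close> is a homomorphism into \<open>Cen(\<phi>)\<close> (\<open>Lambda_hom\<close>).  A matrix that preserves \<open>ker \<Phi>\<close> induces
    a map on the quotient of the row vectors by \<open>ker \<Phi>\<close>, which is the whole module because \<open>\<Phi>\<close> is
    onto.  Multiplication by a matrix on the right commutes with multiplication by polynomials
    on the left, so the induced map is linear and commutes with \<open>\<phi>\<close>, which is the action of \<open>z\<close>.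
    The factors get reversed because the matrices act on the right.

  \<^item> \<open>\<Lambda>\<close> is onto (\<open>Lambda_surj\<close>).  Row vectors form a free module, so \<open>\<psi> \<in> Cen(\<phi>)\<close> lifts along
    \<open>\<Phi>\<close>: take as row \<open>\<gamma>\<close> of the matrix any preimage of \<open>\<psi> (x \<gamma> 0)\<close>.

  \<^item> \<open>\<M>\<^sub>0(X)\<close> is the preimage of \<open>Cen\<^sub>0(\<phi>)\<close> (\<open>M0X_iff_Lambda_Cen0\<close>), because
    \<open>\<Phi>(z f P) = \<phi> (\<Lambda>(P) (\<Phi> f))\<close> and \<open>\<Phi> f\<close> runs through all of the module; and for an element of
    \<open>Cen(\<phi>)\<close> it suffices that one of the two products with \<open>\<phi>\<close> vanishes.

  Hence \<open>\<Lambda>\<close> restricts to a homomorphism from \<open>\<M>\<^sub>0(X)\<close> onto \<open>Cen\<^sub>0(\<phi>)\<close> with the same kernel as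
  \<open>\<Lambda>\<close>, and its composition with the projection from \<open>Cen(\<phi>)\<close> to \<open>Cen(\<phi>)/Cen\<^sub>0(\<phi>)\<close> has kernel
  \<open>\<M>\<^sub>0(X)\<close>.
\<close>

section \<open>Quotients of non-unital algebras\<close>

text \<open>
  Closure under negation follows from the other closure properties, as negation is multiplication by
  the scalar \<open>-1\<close>.
\<close>

lemma (in nonunital_algebra) additive_subgroupI_smult:
  assumes "S \<subseteq> carrier A" and "\<zero>\<^bsub>A\<^esub> \<in> S"
    and "\<And>a b. a \<in> S \<Longrightarrow> b \<in> S \<Longrightarrow> a \<oplus>\<^bsub>A\<^esub> b \<in> S"
    and "\<And>c a. c \<in> carrier K \<Longrightarrow> a \<in> S \<Longrightarrow> c \<odot>\<^bsub>A\<^esub> a \<in> S"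
  shows "additive_subgroup S A"
proof -
  have "\<ominus>\<^bsub>A\<^esub> a \<in> S" if "a \<in> S" for a
  proof -
    have "(\<ominus>\<^bsub>K\<^esub> \<one>\<^bsub>K\<^esub>) \<odot>\<^bsub>A\<^esub> a = \<ominus>\<^bsub>A\<^esub> a"
      using that assms(1) smult_l_minus[of "\<one>\<^bsub>K\<^esub>" a] by (simp add: subset_iff)
    then show ?thesis
      using assms(4)[of "\<ominus>\<^bsub>K\<^esub> \<one>\<^bsub>K\<^esub>" a] that by simp
  qed
  then show ?thesis
    using assms by (intro additive_subgroupI add.subgroupI) (auto simp: a_inv_def)
qed

lemma (in nonunital_algebra) subalgebra:
  assumes "S \<subseteq> carrier A" and "\<zero>\<^bsub>A\<^esub> \<in> S"
    and "\<And>a b. a \<in> S \<Longrightarrow> b \<in> S \<Longrightarrow> a \<oplus>\<^bsub>A\<^esub> b \<in> S"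
    and "\<And>a b. a \<in> S \<Longrightarrow> b \<in> S \<Longrightarrow> a \<otimes>\<^bsub>A\<^esub> b \<in> S"
    and "\<And>c a. c \<in> carrier K \<Longrightarrow> a \<in> S \<Longrightarrow> c \<odot>\<^bsub>A\<^esub> a \<in> S"
  shows "nonunital_algebra K (A\<lparr>carrier := S\<rparr>)"
proof -
  interpret S: additive_subgroup S A
    using assms by (intro additive_subgroupI_smult)
  have "abelian_group (A\<lparr>carrier := S\<rparr>)"
  proof (rule abelian_groupI)
    fix a assume "a \<in> carrier (A\<lparr>carrier := S\<rparr>)"
    then show "\<exists>b\<in>carrier (A\<lparr>carrier := S\<rparr>). b \<oplus>\<^bsub>A\<lparr>carrier := S\<rparr>\<^esub> a = \<zero>\<^bsub>A\<lparr>carrier := S\<rparr>\<^esub>"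
      using S.a_inv_closed assms(1) by (auto intro!: bexI[of _ "\<ominus>\<^bsub>A\<^esub> a"] simp: subset_iff M.l_neg)
  qed (use assms in \<open>auto simp: subset_iff M.a_ac\<close>)
  moreover have "cring K" ..
  ultimately show ?thesis
    using assms unfolding nonunital_algebra_def
    by (intro conjI Module.moduleI nonunital_algebra_axioms.intro)
       (auto simp: subset_iff smult_l_distr smult_r_distr smult_assoc1 mult_assoc mult_l_distr
         mult_r_distr smult_mult_left smult_mult_right)
qed

lemma (in nonunital_algebra) ideal_subalgebra:
  assumes "algebra_ideal K I A"
  shows "nonunital_algebra K (A\<lparr>carrier := I\<rparr>)"
proof -
  interpret I: additive_subgroup I A
    using assms by (simp add: algebra_ideal_def)
  show ?thesis
    using assms I.a_subset by (intro subalgebra) (auto simp: algebra_ideal_def)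
qed

lemma nonunital_algebra_opposite:
  assumes "nonunital_algebra K A"
  shows "nonunital_algebra K (opposite_algebra A)"
proof -
  interpret nonunital_algebra K A by fact
  have "abelian_group (opposite_algebra A)"
    unfolding opposite_algebra_def
    by (rule abelian_groupI) (auto simp: M.a_ac intro: bexI[of _ "\<ominus>\<^bsub>A\<^esub> _"] M.l_neg)
  moreover have "cring K" ..
  ultimately show ?thesis
    unfolding nonunital_algebra_def
    by (intro conjI Module.moduleI nonunital_algebra_axioms.intro)
       (auto simp: opposite_algebra_def smult_l_distr smult_r_distr smult_assoc1 mult_assoc
         mult_closed mult_l_distr mult_r_distr smult_mult_left smult_mult_right)
qed

definition algebra_hom ::
    "('k, 'l) ring_scheme \<Rightarrow> ('k, 'a, 'c) module_scheme \<Rightarrow> ('k, 'b, 'd) module_scheme \<Rightarrow> ('a \<Rightarrow> 'b) \<Rightarrow> bool"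
  where
  "algebra_hom K A B f \<longleftrightarrow>
     f \<in> carrier A \<rightarrow> carrier B \<and>
     (\<forall>x\<in>carrier A. \<forall>y\<in>carrier A. f (x \<oplus>\<^bsub>A\<^esub> y) = f x \<oplus>\<^bsub>B\<^esub> f y) \<and>
     (\<forall>x\<in>carrier A. \<forall>y\<in>carrier A. f (x \<otimes>\<^bsub>A\<^esub> y) = f x \<otimes>\<^bsub>B\<^esub> f y) \<and>
     (\<forall>c\<in>carrier K. \<forall>x\<in>carrier A. f (c \<odot>\<^bsub>A\<^esub> x) = c \<odot>\<^bsub>B\<^esub> f x)"

lemma algebra_hom_comp:
  "algebra_hom K A B f \<Longrightarrow> algebra_hom K B C g \<Longrightarrow> algebra_hom K A C (g \<circ> f)"
  by (auto simp: algebra_hom_def Pi_iff)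

lemma algebra_hom_restrict:
  assumes "algebra_hom K A B f" and "S \<subseteq> carrier A" and "f ` S \<subseteq> T"
  shows "algebra_hom K (A\<lparr>carrier := S\<rparr>) (B\<lparr>carrier := T\<rparr>) f"
  using assms by (auto simp: algebra_hom_def subset_iff)

context nonunital_algebra
begin

lemma quotient_cosets:
  "carrier (quotient_algebra A I) = (\<lambda>a. I +>\<^bsub>A\<^esub> a) ` carrier A"
  by (auto simp: quotient_algebra_def A_RCOSETS_def' a_r_coset_def')

context
  fixes I
  assumes ideal: "algebra_ideal K I A"
begin

lemma ideal_abelian_subgroup: "abelian_subgroup I A"
  using ideal by (intro abelian_subgroupI3) (auto simp: algebra_ideal_def M.abelian_group_axioms)

interpretation I: abelian_subgroup I A
  by (rule ideal_abelian_subgroup)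

lemma coset_eqI:
  assumes "a \<in> carrier A" "i \<in> I" "b = i \<oplus>\<^bsub>A\<^esub> a"
  shows "I +>\<^bsub>A\<^esub> b = I +>\<^bsub>A\<^esub> a"
  using assms I.a_repr_independence'[of b a] M.a_rcosI[of i I a] I.a_subset by auto

lemma coset_eq_ideal_iff:
  assumes "a \<in> carrier A"
  shows "I +>\<^bsub>A\<^esub> a = I \<longleftrightarrow> a \<in> I"
  using assms M.a_coset_join2[of a I] I.a_rcos_self[of a] I.a_subgroup by auto

lemma quotient_add:
  assumes "a \<in> carrier A" "b \<in> carrier A"
  shows "(I +>\<^bsub>A\<^esub> a) \<oplus>\<^bsub>quotient_algebra A I\<^esub> (I +>\<^bsub>A\<^esub> b) = I +>\<^bsub>A\<^esub> (a \<oplus>\<^bsub>A\<^esub> b)"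
  using assms by (simp add: quotient_algebra_def I.a_rcos_sum)

lemma in_coset_iff: "a' \<in> I +>\<^bsub>A\<^esub> a \<longleftrightarrow> (\<exists>i\<in>I. a' = i \<oplus>\<^bsub>A\<^esub> a)"
  by (auto simp: a_r_coset_def')

text \<open>
  The product of two cosets is defined as a union over all representatives; the ideal property makes
  all members of this union equal.
\<close>

lemma quotient_mult:
  assumes a: "a \<in> carrier A" and b: "b \<in> carrier A"
  shows "(I +>\<^bsub>A\<^esub> a) \<otimes>\<^bsub>quotient_algebra A I\<^esub> (I +>\<^bsub>A\<^esub> b) = I +>\<^bsub>A\<^esub> (a \<otimes>\<^bsub>A\<^esub> b)"
proof -
  have "I +>\<^bsub>A\<^esub> (a' \<otimes>\<^bsub>A\<^esub> b') = I +>\<^bsub>A\<^esub> (a \<otimes>\<^bsub>A\<^esub> b)"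
    if "a' \<in> I +>\<^bsub>A\<^esub> a" "b' \<in> I +>\<^bsub>A\<^esub> b" for a' b'
  proof -
    from that obtain i j where i: "i \<in> I" "a' = i \<oplus>\<^bsub>A\<^esub> a" and j: "j \<in> I" "b' = j \<oplus>\<^bsub>A\<^esub> b"
      by (auto simp: in_coset_iff)
    have car: "i \<in> carrier A" "j \<in> carrier A"
      using i j I.a_subset by auto
    have "i \<otimes>\<^bsub>A\<^esub> (j \<oplus>\<^bsub>A\<^esub> b) \<in> I" "a \<otimes>\<^bsub>A\<^esub> j \<in> I"
      using ideal i j a b car by (auto simp: algebra_ideal_def)
    moreover have "a' \<otimes>\<^bsub>A\<^esub> b' = (i \<otimes>\<^bsub>A\<^esub> (j \<oplus>\<^bsub>A\<^esub> b) \<oplus>\<^bsub>A\<^esub> a \<otimes>\<^bsub>A\<^esub> j) \<oplus>\<^bsub>A\<^esub> a \<otimes>\<^bsub>A\<^esub> b"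
      using a b car by (simp add: i j mult_l_distr mult_r_distr mult_closed M.a_ac)
    ultimately show ?thesis
      using a b by (intro coset_eqI) (auto simp: mult_closed)
  qed
  moreover have "a \<in> I +>\<^bsub>A\<^esub> a" "b \<in> I +>\<^bsub>A\<^esub> b"
    using a b by (simp_all add: I.a_rcos_self)
  ultimately have "rcoset_mult A I (I +>\<^bsub>A\<^esub> a) (I +>\<^bsub>A\<^esub> b) = I +>\<^bsub>A\<^esub> (a \<otimes>\<^bsub>A\<^esub> b)"
    unfolding rcoset_mult_def by blast
  then show ?thesis
    by (simp add: quotient_algebra_def)
qed

lemma quotient_smult:
  assumes c: "c \<in> carrier K" and a: "a \<in> carrier A"
  shows "c \<odot>\<^bsub>quotient_algebra A I\<^esub> (I +>\<^bsub>A\<^esub> a) = I +>\<^bsub>A\<^esub> (c \<odot>\<^bsub>A\<^esub> a)"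
proof -
  have "I +>\<^bsub>A\<^esub> (c \<odot>\<^bsub>A\<^esub> a') = I +>\<^bsub>A\<^esub> (c \<odot>\<^bsub>A\<^esub> a)" if "a' \<in> I +>\<^bsub>A\<^esub> a" for a'
  proof -
    from that obtain i where i: "i \<in> I" "a' = i \<oplus>\<^bsub>A\<^esub> a"
      by (auto simp: in_coset_iff)
    then show ?thesis
      using ideal c a I.a_subset
      by (intro coset_eqI[of _ "c \<odot>\<^bsub>A\<^esub> i"]) (auto simp: algebra_ideal_def smult_r_distr subset_iff)
  qed
  moreover have "a \<in> I +>\<^bsub>A\<^esub> a"
    using a by (simp add: I.a_rcos_self)
  ultimately have "(\<Union>a'\<in>I +>\<^bsub>A\<^esub> a. I +>\<^bsub>A\<^esub> (c \<odot>\<^bsub>A\<^esub> a')) = I +>\<^bsub>A\<^esub> (c \<odot>\<^bsub>A\<^esub> a)"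
    by blast
  then show ?thesis
    by (simp add: quotient_algebra_def)
qed

lemma quotient_zero: "\<zero>\<^bsub>quotient_algebra A I\<^esub> = I +>\<^bsub>A\<^esub> \<zero>\<^bsub>A\<^esub>"
  using coset_eq_ideal_iff[of "\<zero>\<^bsub>A\<^esub>"] by (simp add: quotient_algebra_def)

lemmas quotient_ops = quotient_cosets quotient_add quotient_mult quotient_smult quotient_zero

lemma nonunital_algebra_quotient: "nonunital_algebra K (quotient_algebra A I)"
proof -
  have "abelian_group (quotient_algebra A I)"
  proof (rule abelian_groupI)
    fix X assume "X \<in> carrier (quotient_algebra A I)"
    then obtain a where "a \<in> carrier A" "X = I +>\<^bsub>A\<^esub> a"
      by (auto simp: quotient_cosets)
    then show "\<exists>Y\<in>carrier (quotient_algebra A I).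
        Y \<oplus>\<^bsub>quotient_algebra A I\<^esub> X = \<zero>\<^bsub>quotient_algebra A I\<^esub>"
      by (intro bexI[of _ "I +>\<^bsub>A\<^esub> (\<ominus>\<^bsub>A\<^esub> a)"]) (auto simp: quotient_ops M.l_neg)
  qed (auto simp: quotient_ops M.a_ac)
  moreover have "cring K" ..
  ultimately show ?thesis
    unfolding nonunital_algebra_def
    by (intro conjI Module.moduleI nonunital_algebra_axioms.intro)
       (auto simp: quotient_ops smult_l_distr smult_r_distr smult_assoc1 mult_assoc mult_closed
         mult_l_distr mult_r_distr smult_mult_left smult_mult_right)
qed

lemma quotient_projection: "algebra_hom K A (quotient_algebra A I) (\<lambda>a. I +>\<^bsub>A\<^esub> a)"
  by (auto simp: algebra_hom_def quotient_ops)

end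

end

text \<open>
  The kernel \<open>I\<close> is a variable constrained by an equation so that the rule applies to ideals that
  have a name of their own.
\<close>

theorem first_isomorphism:
  assumes A: "nonunital_algebra K A" and B: "nonunital_algebra K B"
    and hom: "algebra_hom K A B f" and surj: "f ` carrier A = carrier B"
    and I: "I = {a \<in> carrier A. f a = \<zero>\<^bsub>B\<^esub>}"
  shows "algebra_ideal K I A"
    and "\<exists>h. algebra_iso K (quotient_algebra A I) B h \<and> (\<forall>a\<in>carrier A. h (I +>\<^bsub>A\<^esub> a) = f a)"
proof -
  interpret A: nonunital_algebra K A by fact
  interpret B: nonunital_algebra K B by fact
  have f_car: "f a \<in> carrier B" if "a \<in> carrier A" for a
    using hom that by (auto simp: algebra_hom_def)
  have f_add: "f (a \<oplus>\<^bsub>A\<^esub> b) = f a \<oplus>\<^bsub>B\<^esub> f b" if "a \<in> carrier A" "b \<in> carrier A" for a b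
    using hom that by (auto simp: algebra_hom_def)
  have f_mult: "f (a \<otimes>\<^bsub>A\<^esub> b) = f a \<otimes>\<^bsub>B\<^esub> f b" if "a \<in> carrier A" "b \<in> carrier A" for a b
    using hom that by (auto simp: algebra_hom_def)
  have f_smult: "f (c \<odot>\<^bsub>A\<^esub> a) = c \<odot>\<^bsub>B\<^esub> f a" if "c \<in> carrier K" "a \<in> carrier A" for c a
    using hom that by (auto simp: algebra_hom_def)
  have zero: "f \<zero>\<^bsub>A\<^esub> = \<zero>\<^bsub>B\<^esub>"
    using f_smult[of "\<zero>\<^bsub>K\<^esub>" "\<zero>\<^bsub>A\<^esub>"] f_car[of "\<zero>\<^bsub>A\<^esub>"] by simp
  \<comment> \<open>Zero annihilates \<open>b\<close> because it is the scalar multiple \<open>0 b\<close> and scalars move out of products.\<close>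
  have zero_mult: "\<zero>\<^bsub>B\<^esub> \<otimes>\<^bsub>B\<^esub> b = \<zero>\<^bsub>B\<^esub>" "b \<otimes>\<^bsub>B\<^esub> \<zero>\<^bsub>B\<^esub> = \<zero>\<^bsub>B\<^esub>" if "b \<in> carrier B" for b
    using that B.smult_mult_left[of "\<zero>\<^bsub>K\<^esub>" b b] B.smult_mult_right[of "\<zero>\<^bsub>K\<^esub>" b b]
    by (simp_all add: B.mult_closed)
  show ideal: "algebra_ideal K I A"
    unfolding algebra_ideal_def
    by (intro conjI A.additive_subgroupI_smult)
       (auto simp: I f_add f_mult f_smult f_car zero zero_mult A.mult_closed)
  interpret I: abelian_subgroup I A
    by (rule A.ideal_abelian_subgroup[OF ideal])
  have coset_iff: "I +>\<^bsub>A\<^esub> a = I +>\<^bsub>A\<^esub> b \<longleftrightarrow> f a = f b"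
    if a: "a \<in> carrier A" and b: "b \<in> carrier A" for a b
  proof -
    have "f a = f ((a \<ominus>\<^bsub>A\<^esub> b) \<oplus>\<^bsub>A\<^esub> b)"
      using a b by (simp add: a_minus_def A.M.a_assoc A.M.l_neg)
    then have fa: "f a = f (a \<ominus>\<^bsub>A\<^esub> b) \<oplus>\<^bsub>B\<^esub> f b"
      using a b by (simp add: f_add)
    have "I +>\<^bsub>A\<^esub> a = I +>\<^bsub>A\<^esub> b \<longleftrightarrow> a \<in> I +>\<^bsub>A\<^esub> b"
      using a b I.a_repr_independence'[of a b] I.a_rcos_self[of a] by auto
    also have "\<dots> \<longleftrightarrow> a \<ominus>\<^bsub>A\<^esub> b \<in> I"
      using a b I.a_rcos_module[of b a] A.M.abelian_group_axioms by (simp add: a_minus_def)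
    also have "\<dots> \<longleftrightarrow> f a = f b"
    proof -
      have "d \<oplus>\<^bsub>B\<^esub> e = e \<longleftrightarrow> d = \<zero>\<^bsub>B\<^esub>" if "d \<in> carrier B" "e \<in> carrier B" for d e
        using that B.M.add.r_cancel_one'[of e d] by auto
      from this[of "f (a \<ominus>\<^bsub>A\<^esub> b)" "f b"] show ?thesis
        using a b f_car unfolding fa I by simp
    qed
    finally show ?thesis .
  qed
  define h where "h X = f (SOME a. a \<in> carrier A \<and> X = I +>\<^bsub>A\<^esub> a)" for X
  have h: "h (I +>\<^bsub>A\<^esub> a) = f a" if "a \<in> carrier A" for a
  proof -
    have "\<exists>b. b \<in> carrier A \<and> I +>\<^bsub>A\<^esub> a = I +>\<^bsub>A\<^esub> b"
      using that by auto
    from someI_ex[OF this] show ?thesis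
      using that coset_iff unfolding h_def by metis
  qed
  have "bij_betw h (carrier (quotient_algebra A I)) (carrier B)"
    unfolding A.quotient_cosets bij_betw_def surj[symmetric]
    by (auto simp: inj_on_def h coset_iff image_image)
  moreover have "nonunital_algebra K (quotient_algebra A I)"
    by (rule A.nonunital_algebra_quotient[OF ideal])
  ultimately have "algebra_iso K (quotient_algebra A I) B h"
    using B unfolding algebra_iso_def
    by (auto simp: A.quotient_ops[OF ideal] A.quotient_cosets h f_add f_mult f_smult A.mult_closed)
  with h show "\<exists>h. algebra_iso K (quotient_algebra A I) B h \<and> (\<forall>a\<in>carrier A. h (I +>\<^bsub>A\<^esub> a) = f a)"
    by blast
qed

section \<open>Polynomials with noncommuting coefficients\<close>

lemma poly_mapping_single_induct [case_names single add]:
  fixes p :: "'a \<Rightarrow>\<^sub>0 'b::comm_monoid_add"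
  assumes single: "\<And>i a. P (Poly_Mapping.single i a)"
    and add: "\<And>p q. P p \<Longrightarrow> P q \<Longrightarrow> P (p + q)"
  shows "P p"
proof (induction p rule: update_induct)
  case const
  show ?case
    using single[of _ 0] by simp
next
  case (update f i a)
  have "Poly_Mapping.update i a f = Poly_Mapping.single i a + f"
    using update by (intro poly_mapping_eqI) (auto simp: lookup_update lookup_add lookup_single when_def in_keys_iff)
  then show ?case
    using add[OF single update.IH] by simp
qed

lemma lookup_const_mult:
  "Poly_Mapping.lookup (Poly_Mapping.single 0 a * (p :: 'r::{ring,monoid_mult} ncpoly)) i = a * Poly_Mapping.lookup p i"
  by (induction p rule: poly_mapping_single_induct)
     (auto simp: mult_single lookup_single when_def distrib_left lookup_add)

lemma lookup_polyvar_mult: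
  "Poly_Mapping.lookup (polyvar * (p :: 'r::{ring,monoid_mult} ncpoly)) i =
     (case i of 0 \<Rightarrow> 0 | Suc j \<Rightarrow> Poly_Mapping.lookup p j)"
  by (induction p rule: poly_mapping_single_induct)
     (auto simp: polyvar_def mult_single lookup_single when_def distrib_left lookup_add split: nat.split)

text \<open>
  This covers both the constants from the centre of the coefficient ring and, with \<open>c = 1\<close>, the powers
  of the indeterminate.
\<close>

lemma single_central_commute:
  fixes p :: "'r::{ring,monoid_mult} ncpoly"
  assumes "\<And>r. c * r = r * c"
  shows "Poly_Mapping.single j c * p = p * Poly_Mapping.single j c"
  by (induction p rule: poly_mapping_single_induct)
     (simp_all add: mult_single distrib_left distrib_right assms add.commute)

lemma const_one_mult:
  fixes p :: "'r::{ring,monoid_mult} ncpoly"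
  shows "Poly_Mapping.single 0 1 * p = p" "p * Poly_Mapping.single 0 1 = p"
proof -
  show "Poly_Mapping.single 0 1 * p = p"
    by (rule poly_mapping_eqI) (simp add: lookup_const_mult)
  then show "p * Poly_Mapping.single 0 1 = p"
    using single_central_commute[of 1 0 p] by simp
qed

text \<open>
  Polynomials are generated from \<open>1\<close> by addition and by left multiplication with constants and with the
  indeterminate.  For maps that respect these three operations the rule replaces an explicit
  formula for the action of a polynomial.
\<close>

lemma ncpoly_induct [case_names one add const var]:
  fixes p :: "'r::{ring,monoid_mult} ncpoly"
  assumes one: "P (Poly_Mapping.single 0 1)"
    and add: "\<And>p q. P p \<Longrightarrow> P q \<Longrightarrow> P (p + q)"
    and const: "\<And>a p. P p \<Longrightarrow> P (Poly_Mapping.single 0 a * p)"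
    and var: "\<And>p. P p \<Longrightarrow> P (polyvar * p)"
  shows "P p"
proof (induction p rule: poly_mapping_single_induct)
  case (single i a)
  have "P (Poly_Mapping.single i 1)"
    by (induction i) (use one var in \<open>force simp: polyvar_def mult_single\<close>)+
  from const[OF this, of a] show ?case
    by (simp add: mult_single)
qed (rule add)

section \<open>Row vectors over the polynomial ring\<close>

definition unit_row :: "nat \<Rightarrow> nat \<Rightarrow> 'r::{ring,monoid_mult} ncpoly mat" where
  "unit_row m \<gamma> = mat 1 m (\<lambda>(_, j). if j = \<gamma> then Poly_Mapping.single 0 1 else 0)"

text \<open>
  Row vectors are generated by the unit rows as a left module over the polynomial ring: maps that are
  additive and compatible with constants and with the indeterminate are determined by their values
  on the unit rows.
\<close>

lemma row_induct [consumes 1, case_names unit zero add const var]: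
  fixes f :: "'r::{ring,monoid_mult} ncpoly mat"
  assumes f: "f \<in> carrier_mat 1 m"
    and unit: "\<And>\<gamma>. \<gamma> < m \<Longrightarrow> P (unit_row m \<gamma>)"
    and zero: "P (0\<^sub>m 1 m)"
    and add: "\<And>f g. f \<in> carrier_mat 1 m \<Longrightarrow> g \<in> carrier_mat 1 m \<Longrightarrow> P f \<Longrightarrow> P g \<Longrightarrow> P (f + g)"
    and const: "\<And>a f. f \<in> carrier_mat 1 m \<Longrightarrow> P f \<Longrightarrow> P (Poly_Mapping.single 0 a \<cdot>\<^sub>m f)"
    and var: "\<And>f. f \<in> carrier_mat 1 m \<Longrightarrow> P f \<Longrightarrow> P (polyvar \<cdot>\<^sub>m f)"
  shows "P f"
proof -
  have unit_car: "p \<cdot>\<^sub>m unit_row m \<gamma> \<in> carrier_mat 1 m" for p :: "'r ncpoly" and \<gamma>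
    by (simp add: unit_row_def)
  have coordinate: "P (p \<cdot>\<^sub>m unit_row m \<gamma>)" if "\<gamma> < m" for p \<gamma>
  proof (induction p rule: ncpoly_induct)
    case one
    have "Poly_Mapping.single 0 1 \<cdot>\<^sub>m unit_row m \<gamma> = (unit_row m \<gamma> :: 'r ncpoly mat)"
      by (auto simp: const_one_mult)
    then show ?case
      using unit[OF that] by simp
  next
    case (add p q)
    have "(p + q) \<cdot>\<^sub>m unit_row m \<gamma> = p \<cdot>\<^sub>m unit_row m \<gamma> + q \<cdot>\<^sub>m unit_row m \<gamma>"
      by (auto simp: distrib_right)
    then show ?case
      using assms(4)[OF unit_car unit_car add] by simp
  next
    case (const a p)
    have "(Poly_Mapping.single 0 a * p) \<cdot>\<^sub>m unit_row m \<gamma> = Poly_Mapping.single 0 a \<cdot>\<^sub>m (p \<cdot>\<^sub>m unit_row m \<gamma>)"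
      by (auto simp: mult.assoc)
    then show ?case
      using assms(5)[OF unit_car const] by simp
  next
    case (var p)
    have "(polyvar * p) \<cdot>\<^sub>m unit_row m \<gamma> = polyvar \<cdot>\<^sub>m (p \<cdot>\<^sub>m unit_row m \<gamma>)"
      by (auto simp: mult.assoc)
    then show ?case
      using assms(6)[OF unit_car var] by simp
  qed
  \<comment> \<open>Induction on the number \<open>n\<close> of leading entries that are kept: each step adds a multiple of one unit row.\<close>
  have truncated: "P (mat 1 m (\<lambda>(_, j). if j < n then f $$ (0, j) else 0))" if "n \<le> m" for n
    using that
  proof (induction n)
    case 0
    have zero_mat: "mat 1 m (\<lambda>(_, j). if j < (0::nat) then f $$ (0, j) else 0) = 0\<^sub>m 1 m"
      by auto
    show ?case
      unfolding zero_mat by (rule zero)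
  next
    case (Suc n)
    have "mat 1 m (\<lambda>(_, j). if j < Suc n then f $$ (0, j) else 0) =
        mat 1 m (\<lambda>(_, j). if j < n then f $$ (0, j) else 0) + f $$ (0, n) \<cdot>\<^sub>m unit_row m n"
      by (auto simp: unit_row_def const_one_mult less_Suc_eq)
    moreover have "P (mat 1 m (\<lambda>(_, j). if j < n then f $$ (0, j) else 0) + f $$ (0, n) \<cdot>\<^sub>m unit_row m n)"
      using Suc by (intro add unit_car coordinate) auto
    ultimately show ?case
      by (simp only:)
  qed
  have "mat 1 m (\<lambda>(_, j). if j < m then f $$ (0, j) else 0) = f"
    using f by (intro eq_matI) auto
  with truncated[OF order_refl] show ?thesis
    by (simp only:)
qed

section \<open>Matrices over the polynomial ring as an algebra over the centre\<close>

lemma cring_centre: "cring (centre_ring :: 'r::{ring,monoid_mult} ring)"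
proof -
  let ?Z = "centre_ring :: 'r ring"
  have mult: "(c * d) * r = r * (c * d)"
    if "\<forall>r. c * r = r * c" "\<forall>r. d * r = r * d" for c d r :: 'r
    using that by (metis mult.assoc)
  have "abelian_group ?Z"
  proof (rule abelian_groupI, goal_cases)
    case (6 c)
    then show ?case
      by (intro bexI[of _ "- c"]) (auto simp: centre_ring_def)
  qed (auto simp: centre_ring_def distrib_left distrib_right add_ac)
  moreover have "comm_monoid ?Z"
  proof (rule comm_monoidI, goal_cases)
    case (1 c d)
    then have "\<forall>r. c * r = r * c" "\<forall>r. d * r = r * d"
      by (simp_all add: centre_ring_def)
    then have "\<forall>r. (c * d) * r = r * (c * d)"
      by (blast intro: mult)
    then show ?case
      unfolding centre_ring_def partial_object.simps monoid.simps mem_Collect_eq .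
  next
    case (3 c d e)
    show ?case
      by (simp only: centre_ring_def monoid.simps mult.assoc)
  next
    case (5 c d)
    then have "\<forall>r. c * r = r * c"
      by (simp add: centre_ring_def)
    then show ?case
      by (simp only: centre_ring_def monoid.simps)
  qed (auto simp: centre_ring_def)
  ultimately show ?thesis
  proof (rule cringI, goal_cases)
    case (1 c d e)
    show ?case
      by (simp only: centre_ring_def monoid.simps ring_record_simps distrib_right)
  qed
qed

lemma centre_ring_ops:
  "x \<otimes>\<^bsub>centre_ring\<^esub> y = x * y" "x \<oplus>\<^bsub>centre_ring\<^esub> y = x + y" "\<one>\<^bsub>centre_ring\<^esub> = 1"
  by (simp_all add: centre_ring_def)

lemma const_central_commute:
  fixes p :: "'r::{ring,monoid_mult} ncpoly"
  assumes "c \<in> carrier (centre_ring :: 'r::{ring,monoid_mult} ring)"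
  shows "Poly_Mapping.single 0 c * p = p * Poly_Mapping.single 0 c"
  using assms by (intro single_central_commute) (simp add: centre_ring_def)

text \<open>
  Pulling a left scalar out of the first factor of a product is associativity alone.  Pulling it out of the
  second factor exchanges it with the entries of the first one, so there it has to be central.
\<close>

lemma smult_mult_mat:
  fixes A B :: "'a::ring mat"
  assumes "dim_col A = dim_row B"
  shows "p \<cdot>\<^sub>m A * B = p \<cdot>\<^sub>m (A * B)"
  using assms by (auto simp: scalar_prod_def sum_distrib_left mult.assoc)

lemma mult_smult_mat_central:
  fixes A B :: "'a::ring mat"
  assumes central: "\<And>q. p * q = q * p" and dim: "dim_col A = dim_row B"
  shows "A * (p \<cdot>\<^sub>m B) = p \<cdot>\<^sub>m (A * B)"
proof (rule eq_matI)
  have swap: "a * (p * b) = p * (a * b)" for a b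
    by (metis central mult.assoc)
  show "(A * (p \<cdot>\<^sub>m B)) $$ (i, j) = (p \<cdot>\<^sub>m (A * B)) $$ (i, j)"
    if "i < dim_row (p \<cdot>\<^sub>m (A * B))" "j < dim_col (p \<cdot>\<^sub>m (A * B))" for i j
    using that dim by (simp add: scalar_prod_def sum_distrib_left swap)
qed simp_all

lemma nonunital_algebra_matrix:
  "nonunital_algebra centre_ring (matrix_algebra m :: ('r::{ring,monoid_mult}, 'r ncpoly mat) module)"
proof -
  let ?A = "matrix_algebra m :: ('r, 'r ncpoly mat) module"
  have "abelian_group ?A"
    unfolding matrix_algebra_def
  proof (rule abelian_groupI, goal_cases)
    case (6 A)
    then show ?case
      by (intro bexI[of _ "- A"]) auto
  qed auto
  moreover have "P * (Poly_Mapping.single 0 c \<cdot>\<^sub>m Q) = Poly_Mapping.single 0 c \<cdot>\<^sub>m (P * Q)"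
    if "c \<in> carrier centre_ring" "P \<in> carrier_mat m m" "Q \<in> carrier_mat m m"
    for c and P Q :: "'r ncpoly mat"
    using that by (intro mult_smult_mat_central const_central_commute) auto
  moreover have "Poly_Mapping.single 0 (c * d) \<cdot>\<^sub>m P = Poly_Mapping.single 0 c \<cdot>\<^sub>m (Poly_Mapping.single 0 d \<cdot>\<^sub>m P)"
    for c d and P :: "'r ncpoly mat"
    by (rule eq_matI) (simp_all add: mult.assoc[symmetric] mult_single)
  moreover have "Poly_Mapping.single 0 (c + d) \<cdot>\<^sub>m P = Poly_Mapping.single 0 c \<cdot>\<^sub>m P + Poly_Mapping.single 0 d \<cdot>\<^sub>m P"
    for c d and P :: "'r ncpoly mat"
    by (auto simp: single_add distrib_right)
  moreover have "p \<cdot>\<^sub>m (P + Q) = p \<cdot>\<^sub>m P + p \<cdot>\<^sub>m Q"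
    if "P \<in> carrier_mat m m" "Q \<in> carrier_mat m m" for p and P Q :: "'r ncpoly mat"
    using that by (auto simp: distrib_left)
  moreover have "Poly_Mapping.single 0 1 \<cdot>\<^sub>m P = P" for P :: "'r ncpoly mat"
    by (auto simp: const_one_mult)
  ultimately show ?thesis
    using cring_centre unfolding nonunital_algebra_def
    by (intro conjI Module.moduleI nonunital_algebra_axioms.intro)
       (simp_all add: matrix_algebra_def centre_ring_ops smult_mult_mat
         add_mult_distrib_mat mult_add_distrib_mat)
qed

section \<open>Endomorphisms and centralizers\<close>

context left_module
begin

lemma scale_zero_left: "scale 0 v = 0"
  using scale_left_distrib[of 0 0 v] by simp

lemma scale_zero_right: "scale r 0 = 0"
  using scale_right_distrib[of r 0 0] by simp

lemma scale_minus_right: "scale r (- v) = - scale r v"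
  using scale_right_distrib[of r v "- v"] by (simp add: scale_zero_right eq_neg_iff_add_eq_0 add.commute)

lemma scale_left_diff: "scale (r - s) v = scale r v - scale s v"
  using scale_left_distrib[of "r - s" s v] by simp

lemma scale_sum_right: "scale r (sum f I) = (\<Sum>i\<in>I. scale r (f i))"
  by (induction I rule: infinite_finite_induct) (simp_all add: scale_zero_right scale_right_distrib)

lemma endomorphism_zero: "module_endomorphism scale \<psi> \<Longrightarrow> \<psi> 0 = 0"
  unfolding module_endomorphism_def by (metis add_cancel_right_right)

lemma endomorphism_sum: "module_endomorphism scale \<psi> \<Longrightarrow> \<psi> (sum f I) = (\<Sum>i\<in>I. \<psi> (f i))"
  by (induction I rule: infinite_finite_induct)
     (simp_all add: endomorphism_zero, simp add: module_endomorphism_def)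

lemma nonunital_algebra_End: "nonunital_algebra centre_ring (End_algebra scale)"
proof -
  have "abelian_group (End_algebra scale)"
  proof (rule abelian_groupI, goal_cases)
    case (6 \<psi>)
    then show ?case
      by (intro bexI[of _ "\<lambda>v. - \<psi> v"])
         (auto simp: End_algebra_def module_endomorphism_def scale_minus_right)
  qed (auto simp: End_algebra_def module_endomorphism_def scale_right_distrib scale_zero_right add_ac)
  moreover have "scale c (scale r v) = scale r (scale c v)" if "c \<in> carrier centre_ring" for c r v
    using that by (simp add: scale_scale centre_ring_def)
  ultimately show ?thesis
    using cring_centre unfolding nonunital_algebra_def
    by (intro conjI Module.moduleI nonunital_algebra_axioms.intro)
       (auto simp: End_algebra_def module_endomorphism_def centre_ring_ops scale_right_distrib
         scale_left_distrib scale_scale[symmetric] scale_one fun_eq_iff)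
qed

lemma nonunital_algebra_Cen:
  assumes "module_endomorphism scale \<phi>"
  shows "nonunital_algebra centre_ring (Cen_algebra scale \<phi>)"
proof -
  interpret End: nonunital_algebra centre_ring "End_algebra scale"
    by (rule nonunital_algebra_End)
  have \<phi>: "\<phi> (u + v) = \<phi> u + \<phi> v" "\<phi> (scale r v) = scale r (\<phi> v)" "\<phi> 0 = 0" for r u v
    using assms endomorphism_zero[OF assms] by (simp_all add: module_endomorphism_def)
  have Cen_End: "\<psi> \<in> Cen scale \<phi> \<longleftrightarrow> \<psi> \<in> carrier (End_algebra scale) \<and> (\<forall>v. \<psi> (\<phi> v) = \<phi> (\<psi> v))" for \<psi>
    by (auto simp: Cen_def End_algebra_def fun_eq_iff)
  have "\<zero>\<^bsub>End_algebra scale\<^esub> v = 0" "(\<psi> \<oplus>\<^bsub>End_algebra scale\<^esub> \<chi>) v = \<psi> v + \<chi> v"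
    "(\<psi> \<otimes>\<^bsub>End_algebra scale\<^esub> \<chi>) v = \<psi> (\<chi> v)"
    "(c \<odot>\<^bsub>End_algebra scale\<^esub> \<psi>) v = scale c (\<psi> v)" for \<psi> \<chi> c v
    by (simp_all add: End_algebra_def)
  then show ?thesis
    unfolding Cen_algebra_def
    by (intro End.subalgebra) (auto simp: Cen_End \<phi> End.mult_closed)
qed

lemma Cen0_ideal:
  assumes "module_endomorphism scale \<phi>"
  shows "algebra_ideal centre_ring (Cen0 scale \<phi>) (Cen_algebra scale \<phi>)"
proof -
  interpret Cen: nonunital_algebra centre_ring "Cen_algebra scale \<phi>"
    using assms by (rule nonunital_algebra_Cen)
  have \<phi>: "\<phi> (u + v) = \<phi> u + \<phi> v" "\<phi> (scale r v) = scale r (\<phi> v)" "\<phi> 0 = 0" for r u v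
    using assms endomorphism_zero[OF assms] by (simp_all add: module_endomorphism_def)
  have Cen0_Cen: "\<psi> \<in> Cen0 scale \<phi> \<longleftrightarrow>
      \<psi> \<in> carrier (Cen_algebra scale \<phi>) \<and> (\<forall>v. \<psi> (\<phi> v) = 0) \<and> (\<forall>v. \<phi> (\<psi> v) = 0)" for \<psi>
    by (auto simp: Cen0_def Cen_def Cen_algebra_def fun_eq_iff)
  have Cen_zero: "\<psi> 0 = 0" "\<psi> (\<phi> v) = \<phi> (\<psi> v)" if "\<psi> \<in> carrier (Cen_algebra scale \<phi>)" for \<psi> v
    using that endomorphism_zero[of \<psi>] by (auto simp: Cen_algebra_def Cen_def fun_eq_iff)
  \<comment> \<open>An element of the centralizer maps the kernel of \<open>\<phi>\<close> to itself.\<close>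
  have Cen_kernel: "\<phi> (\<psi> v) = 0" if "\<psi> \<in> carrier (Cen_algebra scale \<phi>)" "\<phi> v = 0" for \<psi> v
    using Cen_zero[OF that(1)] that(2) by metis
  have "\<zero>\<^bsub>Cen_algebra scale \<phi>\<^esub> v = 0" "(\<psi> \<oplus>\<^bsub>Cen_algebra scale \<phi>\<^esub> \<chi>) v = \<psi> v + \<chi> v"
    "(\<psi> \<otimes>\<^bsub>Cen_algebra scale \<phi>\<^esub> \<chi>) v = \<psi> (\<chi> v)"
    "(c \<odot>\<^bsub>Cen_algebra scale \<phi>\<^esub> \<psi>) v = scale c (\<psi> v)" for \<psi> \<chi> c v
    by (simp_all add: End_algebra_def Cen_algebra_def)
  then show ?thesis
    unfolding algebra_ideal_def
    by (intro conjI Cen.additive_subgroupI_smult)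
       (auto simp: Cen0_Cen \<phi> Cen.mult_closed Cen_zero Cen_kernel scale_zero_right)
qed

end

section \<open>The homomorphism \<open>\<Phi>\<close>\<close>

locale jordan_module = left_module scale
  for scale :: "'r::{ring,monoid_mult} \<Rightarrow> 'm::ab_group_add \<Rightarrow> 'm" +
  fixes \<phi> :: "'m \<Rightarrow> 'm" and m :: nat and k :: "nat \<Rightarrow> nat" and x :: "nat \<Rightarrow> nat \<Rightarrow> 'm"
  assumes endo: "module_endomorphism scale \<phi>"
    and base: "nilpotent_jordan_normal_base scale \<phi> {..<m} k x"
begin

abbreviation \<Phi> :: "'r ncpoly mat \<Rightarrow> 'm" where
  "\<Phi> \<equiv> Phi scale m k x"

lemma block_pos: "\<gamma> < m \<Longrightarrow> 1 \<le> k \<gamma>"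
  and block_step: "\<gamma> < m \<Longrightarrow> Suc i < k \<gamma> \<Longrightarrow> \<phi> (x \<gamma> i) = x \<gamma> (Suc i)"
  and block_last: "\<gamma> < m \<Longrightarrow> \<phi> (x \<gamma> (k \<gamma> - 1)) = 0"
  using base unfolding nilpotent_jordan_normal_base_def by blast+

lemma Phi_zero: "\<Phi> (0\<^sub>m 1 m) = 0"
  by (simp add: Phi_def scale_zero_left)

lemma Phi_add:
  "f \<in> carrier_mat 1 m \<Longrightarrow> g \<in> carrier_mat 1 m \<Longrightarrow> \<Phi> (f + g) = \<Phi> f + \<Phi> g"
  by (simp add: Phi_def lookup_add scale_left_distrib sum.distrib)

lemma Phi_diff:
  "f \<in> carrier_mat 1 m \<Longrightarrow> g \<in> carrier_mat 1 m \<Longrightarrow> \<Phi> (f - g) = \<Phi> f - \<Phi> g"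
  by (simp add: Phi_def lookup_minus scale_left_diff sum_subtractf)

lemma Phi_const:
  "f \<in> carrier_mat 1 m \<Longrightarrow> \<Phi> (Poly_Mapping.single 0 a \<cdot>\<^sub>m f) = scale a (\<Phi> f)"
  by (simp add: Phi_def lookup_const_mult scale_scale[symmetric] scale_sum_right)

text \<open>
  The indeterminate shifts the coefficients by one position and \<open>\<phi>\<close> shifts each block by one position; the
  coefficient that leaves the block is the one of its last element, which \<open>\<phi>\<close> kills.
\<close>

lemma Phi_polyvar:
  assumes "f \<in> carrier_mat 1 m"
  shows "\<Phi> (polyvar \<cdot>\<^sub>m f) = \<phi> (\<Phi> f)"
proof -
  have "(\<Sum>i<k \<gamma>. scale (Poly_Mapping.lookup (polyvar * p) i) (x \<gamma> i)) =
      \<phi> (\<Sum>i<k \<gamma>. scale (Poly_Mapping.lookup p i) (x \<gamma> i))" if "\<gamma> < m" for \<gamma> p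
  proof -
    obtain n where n: "k \<gamma> = Suc n"
      using block_pos[OF \<open>\<gamma> < m\<close>] by (cases "k \<gamma>") auto
    have \<phi>: "\<phi> (scale r v) = scale r (\<phi> v)" for r v
      using endo by (simp add: module_endomorphism_def)
    have "(\<Sum>i<k \<gamma>. scale (Poly_Mapping.lookup (polyvar * p) i) (x \<gamma> i)) =
        (\<Sum>i<n. scale (Poly_Mapping.lookup p i) (x \<gamma> (Suc i)))"
      by (simp add: n lookup_polyvar_mult sum.lessThan_Suc_shift scale_zero_left del: sum.lessThan_Suc)
    also have "\<dots> = (\<Sum>i<k \<gamma>. scale (Poly_Mapping.lookup p i) (\<phi> (x \<gamma> i)))"
      using block_step[OF that] block_last[OF that] by (simp add: n scale_zero_right)
    also have "\<dots> = \<phi> (\<Sum>i<k \<gamma>. scale (Poly_Mapping.lookup p i) (x \<gamma> i))"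
      by (simp add: endomorphism_sum[OF endo] \<phi>)
    finally show ?thesis .
  qed
  then show ?thesis
    using assms by (simp add: Phi_def endomorphism_sum[OF endo])
qed

lemma Phi_unit_row:
  assumes "\<gamma> < m"
  shows "\<Phi> (unit_row m \<gamma>) = x \<gamma> 0"
proof -
  have pos: "0 < k \<gamma>"
    using block_pos[OF assms] by simp
  have "(\<Sum>i<k \<delta>. scale (Poly_Mapping.lookup (unit_row m \<gamma> $$ (0, \<delta>)) i) (x \<delta> i)) =
      (if \<delta> = \<gamma> then x \<gamma> 0 else 0)" if "\<delta> < m" for \<delta>
  proof (cases "\<delta> = \<gamma>")
    case True
    have "(\<Sum>i<k \<gamma>. scale (Poly_Mapping.lookup (unit_row m \<gamma> $$ (0, \<gamma>)) i) (x \<gamma> i)) =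
        (\<Sum>i<k \<gamma>. if i = 0 then x \<gamma> 0 else 0)"
      using assms by (intro sum.cong) (auto simp: unit_row_def lookup_single when_def scale_one scale_zero_left)
    then show ?thesis
      using True pos by simp
  qed (use that in \<open>simp add: unit_row_def scale_zero_left\<close>)
  then have "\<Phi> (unit_row m \<gamma>) = (\<Sum>\<delta><m. if \<delta> = \<gamma> then x \<gamma> 0 else 0)"
    unfolding Phi_def by (intro sum.cong) auto
  then show ?thesis
    using assms by simp
qed

text \<open>
  The image is a submodule and it contains the whole base, since \<open>x \<gamma> i\<close> is the image of the unit
  row \<open>\<gamma>\<close> multiplied by the \<open>i\<close>-th power of the indeterminate.
\<close>

lemma Phi_surj: obtains f where "f \<in> carrier_mat 1 m" "\<Phi> f = v"
proof -
  let ?N = "\<Phi> ` carrier_mat 1 m"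
  have x_mem: "x \<gamma> i \<in> ?N" if "\<gamma> < m" "i < k \<gamma>" for \<gamma> i
    using that(2)
  proof (induction i)
    case 0
    show ?case
      using Phi_unit_row[OF that(1)] by (intro image_eqI[of _ _ "unit_row m \<gamma>"]) (auto simp: unit_row_def)
  next
    case (Suc i)
    then obtain f where "f \<in> carrier_mat 1 m" "x \<gamma> i = \<Phi> f"
      by auto
    moreover have "\<phi> (x \<gamma> i) = x \<gamma> (Suc i)"
      using that(1) Suc.prems by (rule block_step)
    ultimately show ?case
      using Phi_polyvar[of f] by (intro image_eqI[of _ _ "polyvar \<cdot>\<^sub>m f"]) auto
  qed
  have submodule: "left_submodule scale ?N"
    unfolding left_submodule_def
  proof (intro conjI ballI allI)
    show "0 \<in> ?N"
      using Phi_zero by (metis image_eqI zero_carrier_mat)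
    show "u + v \<in> ?N" if "u \<in> ?N" "v \<in> ?N" for u v
    proof -
      obtain f g where "f \<in> carrier_mat 1 m" "u = \<Phi> f" "g \<in> carrier_mat 1 m" "v = \<Phi> g"
        using \<open>u \<in> ?N\<close> \<open>v \<in> ?N\<close> by blast
      then show ?thesis
        by (intro image_eqI[of _ _ "f + g"]) (auto simp: Phi_add)
    qed
    show "scale r u \<in> ?N" if "u \<in> ?N" for r u
    proof -
      obtain f where "f \<in> carrier_mat 1 m" "u = \<Phi> f"
        using \<open>u \<in> ?N\<close> by blast
      then show ?thesis
        by (intro image_eqI[of _ _ "Poly_Mapping.single 0 r \<cdot>\<^sub>m f"]) (auto simp: Phi_const)
    qed
  qed
  have "scale r (x \<gamma> i) \<in> ?N" if "\<gamma> < m" "i < k \<gamma>" for r \<gamma> i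
    using submodule x_mem[OF that] unfolding left_submodule_def by blast
  then have "(\<Union>(\<gamma>, i)\<in>SIGMA \<gamma>:{..<m}. {..<k \<gamma>}. range (\<lambda>r. scale r (x \<gamma> i))) \<subseteq> ?N"
    by auto
  with submodule have "left_submodule scale hull (\<Union>(\<gamma>, i)\<in>SIGMA \<gamma>:{..<m}. {..<k \<gamma>}. range (\<lambda>r. scale r (x \<gamma> i))) \<subseteq> ?N"
    by (intro hull_minimal)
  moreover have "left_submodule scale hull (\<Union>(\<gamma>, i)\<in>SIGMA \<gamma>:{..<m}. {..<k \<gamma>}. range (\<lambda>r. scale r (x \<gamma> i))) = UNIV"
    using base by (simp add: nilpotent_jordan_normal_base_def internal_direct_sum_def submodule_generated_def)
  ultimately have "v \<in> ?N"
    by blast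
  then show ?thesis
    using that by blast
qed

section \<open>The homomorphism \<open>\<Lambda>\<close>\<close>

abbreviation \<Lambda> :: "'r ncpoly mat \<Rightarrow> 'm \<Rightarrow> 'm" where
  "\<Lambda> \<equiv> Lambda scale \<phi> m k x"

lemma MX_carrier: "P \<in> MX scale m k x \<Longrightarrow> P \<in> carrier_mat m m"
  by (simp add: MX_def)

lemma MX_I:
  assumes "P \<in> carrier_mat m m"
    and "\<And>f. f \<in> carrier_mat 1 m \<Longrightarrow> \<Phi> f = 0 \<Longrightarrow> \<Phi> (f * P) = 0"
  shows "P \<in> MX scale m k x"
  using assms by (auto simp: MX_def ker_Phi_def)

lemma MX_D: "P \<in> MX scale m k x \<Longrightarrow> f \<in> carrier_mat 1 m \<Longrightarrow> \<Phi> f = 0 \<Longrightarrow> \<Phi> (f * P) = 0"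
  by (simp add: MX_def ker_Phi_def)

lemma row_mult_carrier: "P \<in> MX scale m k x \<Longrightarrow> f \<in> carrier_mat 1 m \<Longrightarrow> f * P \<in> carrier_mat 1 m"
  using MX_carrier[of P] by simp

text \<open>
  The value at \<open>\<Phi> f\<close> does not depend on \<open>f\<close> because two preimages differ by an element of \<open>ker \<Phi>\<close>,
  which \<open>P\<close> preserves.
\<close>

lemma induced_endomorphism:
  assumes P: "P \<in> MX scale m k x"
  shows "\<exists>\<psi>\<in>Cen scale \<phi>. \<forall>f\<in>carrier_mat 1 m. \<psi> (\<Phi> f) = \<Phi> (f * P)"
proof -
  have P_car: "P \<in> carrier_mat m m"
    using P by (rule MX_carrier)
  define \<psi> where "\<psi> v = \<Phi> ((SOME f. f \<in> carrier_mat 1 m \<and> \<Phi> f = v) * P)" for v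
  have \<psi>: "\<psi> (\<Phi> f) = \<Phi> (f * P)" if f: "f \<in> carrier_mat 1 m" for f
  proof -
    define g where "g = (SOME g. g \<in> carrier_mat 1 m \<and> \<Phi> g = \<Phi> f)"
    have g: "g \<in> carrier_mat 1 m" "\<Phi> g = \<Phi> f"
      using someI[of "\<lambda>g. g \<in> carrier_mat 1 m \<and> \<Phi> g = \<Phi> f" f] f by (auto simp: g_def)
    then have "g - f \<in> ker_Phi scale m k x"
      using f by (auto simp: ker_Phi_def Phi_diff)
    then have "\<Phi> ((g - f) * P) = 0"
      using P by (simp add: MX_def ker_Phi_def)
    moreover have "(g - f) * P = g * P - f * P"
      using f g P_car by (simp add: minus_mult_distrib_mat)
    moreover have "f * P \<in> carrier_mat 1 m" "g * P \<in> carrier_mat 1 m"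
      using f g P_car by auto
    ultimately show ?thesis
      by (simp add: Phi_diff \<psi>_def g_def)
  qed
  have car: "f * P \<in> carrier_mat 1 m" if "f \<in> carrier_mat 1 m" for f
    using that P_car by simp
  have "\<psi> (u + v) = \<psi> u + \<psi> v" for u v
  proof -
    obtain f g where fg: "f \<in> carrier_mat 1 m" "\<Phi> f = u" "g \<in> carrier_mat 1 m" "\<Phi> g = v"
      by (metis Phi_surj)
    have "\<psi> (\<Phi> (f + g)) = \<Phi> ((f + g) * P)"
      using fg by (intro \<psi>) auto
    also have "\<dots> = \<psi> (\<Phi> f) + \<psi> (\<Phi> g)"
      unfolding \<psi>[OF fg(1)] \<psi>[OF fg(3)] using fg P_car car by (simp add: add_mult_distrib_mat Phi_add)
    finally show ?thesis
      using fg by (simp add: Phi_add)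
  qed
  moreover have "\<psi> (scale r u) = scale r (\<psi> u)" for r u
  proof -
    obtain f where f: "f \<in> carrier_mat 1 m" "\<Phi> f = u"
      by (metis Phi_surj)
    have "\<psi> (\<Phi> (Poly_Mapping.single 0 r \<cdot>\<^sub>m f)) = \<Phi> (Poly_Mapping.single 0 r \<cdot>\<^sub>m f * P)"
      using f by (intro \<psi>) auto
    also have "\<dots> = scale r (\<psi> (\<Phi> f))"
      unfolding \<psi>[OF f(1)] using f P_car car by (simp add: smult_mult_mat Phi_const)
    finally show ?thesis
      using f by (simp add: Phi_const)
  qed
  moreover have "\<psi> (\<phi> u) = \<phi> (\<psi> u)" for u
  proof -
    obtain f where f: "f \<in> carrier_mat 1 m" "\<Phi> f = u"
      by (metis Phi_surj)
    have "\<psi> (\<Phi> (polyvar \<cdot>\<^sub>m f)) = \<Phi> (polyvar \<cdot>\<^sub>m f * P)"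
      using f by (intro \<psi>) auto
    also have "\<dots> = \<phi> (\<psi> (\<Phi> f))"
      unfolding \<psi>[OF f(1)] using f P_car car by (simp add: smult_mult_mat Phi_polyvar)
    finally show ?thesis
      using f by (simp add: Phi_polyvar)
  qed
  ultimately have "\<psi> \<in> Cen scale \<phi>"
    by (auto simp: Cen_def module_endomorphism_def)
  with \<psi> show ?thesis
    by blast
qed

lemma Lambda_eqI:
  assumes "\<psi> \<in> Cen scale \<phi>" and "\<And>f. f \<in> carrier_mat 1 m \<Longrightarrow> \<psi> (\<Phi> f) = \<Phi> (f * P)"
  shows "\<Lambda> P = \<psi>"
  unfolding Lambda_def
proof (rule the_equality)
  fix \<chi> assume "\<chi> \<in> Cen scale \<phi> \<and> (\<forall>f\<in>carrier_mat 1 m. \<chi> (\<Phi> f) = \<Phi> (f * P))"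
  then show "\<chi> = \<psi>"
    using assms Phi_surj by (metis ext)
qed (use assms in auto)

lemma Lambda_Cen: "P \<in> MX scale m k x \<Longrightarrow> \<Lambda> P \<in> Cen scale \<phi>"
  and Lambda_Phi: "P \<in> MX scale m k x \<Longrightarrow> f \<in> carrier_mat 1 m \<Longrightarrow> \<Lambda> P (\<Phi> f) = \<Phi> (f * P)"
  using induced_endomorphism[of P] Lambda_eqI[of _ P] by metis+

text \<open>
  The lifted matrix \<open>P\<close> satisfies \<open>\<psi> \<circ> \<Phi> = \<Phi> \<circ> (\<lambda>f. f * P)\<close> on the unit rows by construction.  Both sides are
  linear over the polynomial ring, hence they agree everywhere; in particular \<open>P\<close> preserves \<open>ker \<Phi>\<close>.
\<close>

lemma Lambda_surj:
  assumes "\<psi> \<in> Cen scale \<phi>"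
  obtains P where "P \<in> MX scale m k x" "\<Lambda> P = \<psi>"
proof -
  have \<psi>: "module_endomorphism scale \<psi>" "\<psi> (u + v) = \<psi> u + \<psi> v" "\<psi> (scale r u) = scale r (\<psi> u)"
    "\<psi> (\<phi> u) = \<phi> (\<psi> u)" "\<psi> 0 = 0" for r u v
    using assms endomorphism_zero[of \<psi>] by (auto simp: Cen_def module_endomorphism_def fun_eq_iff)
  have "\<forall>\<gamma>. \<exists>g. g \<in> carrier_mat 1 m \<and> \<Phi> g = \<psi> (x \<gamma> 0)"
    by (metis Phi_surj)
  then obtain g where g: "\<And>\<gamma>. g \<gamma> \<in> carrier_mat 1 m" "\<And>\<gamma>. \<Phi> (g \<gamma>) = \<psi> (x \<gamma> 0)"
    by metis
  define P where "P = mat m m (\<lambda>(\<gamma>, \<delta>). g \<gamma> $$ (0, \<delta>))"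
  have P_car: "P \<in> carrier_mat m m"
    by (simp add: P_def)
  have row_P: "unit_row m \<gamma> * P = g \<gamma>" if "\<gamma> < m" for \<gamma>
  proof (rule eq_matI)
    fix i j assume "i < dim_row (g \<gamma>)" "j < dim_col (g \<gamma>)"
    then have ij: "i = 0" "j < m"
      using g(1)[of \<gamma>] by auto
    have "(unit_row m \<gamma> * P) $$ (0, j) =
        (\<Sum>\<delta>\<in>{0..<m}. (if \<delta> = \<gamma> then Poly_Mapping.single 0 1 else 0) * g \<delta> $$ (0, j))"
      using ij by (simp add: scalar_prod_def unit_row_def P_def)
    also have "\<dots> = (\<Sum>\<delta>\<in>{0..<m}. if \<delta> = \<gamma> then g \<gamma> $$ (0, j) else 0)"
      by (intro sum.cong) (simp_all add: const_one_mult)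
    finally have "(unit_row m \<gamma> * P) $$ (0, j) = \<dots>" .
    then show "(unit_row m \<gamma> * P) $$ (i, j) = g \<gamma> $$ (i, j)"
      using that ij by simp
  qed (use g(1)[of \<gamma>] P_car in \<open>auto simp: unit_row_def\<close>)
  have car: "f * P \<in> carrier_mat 1 m" if "f \<in> carrier_mat 1 m" for f
    using that P_car by simp
  have \<psi>P: "\<psi> (\<Phi> f) = \<Phi> (f * P)" if "f \<in> carrier_mat 1 m" for f
    using that
  proof (induction f rule: row_induct)
    case (unit \<gamma>)
    then show ?case
      by (simp add: Phi_unit_row row_P g)
  next
    case zero
    have "0\<^sub>m 1 m * P = 0\<^sub>m 1 m"
      using P_car by simp
    then show ?case
      using Phi_zero \<psi> by (simp del: One_nat_def)
  next
    case (add f g)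
    then show ?case
      using P_car car by (simp add: add_mult_distrib_mat Phi_add \<psi>)
  next
    case (const a f)
    then show ?case
      using P_car car by (simp add: smult_mult_mat Phi_const \<psi>)
  next
    case (var f)
    then show ?case
      using P_car car by (simp add: smult_mult_mat Phi_polyvar \<psi>)
  qed
  have "P \<in> MX scale m k x"
  proof (rule MX_I[OF P_car])
    fix f assume f: "f \<in> carrier_mat 1 m" "\<Phi> f = 0"
    show "\<Phi> (f * P) = 0"
      unfolding \<psi>P[OF f(1), symmetric] f(2) by (rule \<psi>(5))
  qed
  with Lambda_eqI[OF assms \<psi>P] that show ?thesis
    by blast
qed

abbreviation M_op :: "('r, 'r ncpoly mat) module" where
  "M_op \<equiv> opposite_algebra (MX_algebra scale m k x)"

abbreviation Cen_alg :: "('r, 'm \<Rightarrow> 'm) module" where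
  "Cen_alg \<equiv> Cen_algebra scale \<phi>"

lemma M_op_simps:
  "carrier M_op = MX scale m k x" "P \<oplus>\<^bsub>M_op\<^esub> Q = P + Q" "P \<otimes>\<^bsub>M_op\<^esub> Q = Q * P"
  "c \<odot>\<^bsub>M_op\<^esub> P = Poly_Mapping.single 0 c \<cdot>\<^sub>m P"
  by (simp_all add: opposite_algebra_def MX_algebra_def matrix_algebra_def)

lemma Cen_simps:
  "carrier Cen_alg = Cen scale \<phi>" "\<psi> \<oplus>\<^bsub>Cen_alg\<^esub> \<chi> = (\<lambda>v. \<psi> v + \<chi> v)" "\<psi> \<otimes>\<^bsub>Cen_alg\<^esub> \<chi> = \<psi> \<circ> \<chi>"
  "c \<odot>\<^bsub>Cen_alg\<^esub> \<psi> = (\<lambda>v. scale c (\<psi> v))" "\<zero>\<^bsub>Cen_alg\<^esub> = (\<lambda>_. 0)"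
  by (simp_all add: Cen_algebra_def End_algebra_def)

lemma const_smult_mult_mat:
  fixes f P :: "'r ncpoly mat"
  assumes "c \<in> carrier centre_ring" "f \<in> carrier_mat n m" "P \<in> carrier_mat m m"
  shows "f * (Poly_Mapping.single 0 c \<cdot>\<^sub>m P) = Poly_Mapping.single 0 c \<cdot>\<^sub>m (f * P)"
  using assms by (intro mult_smult_mat_central const_central_commute) auto

lemma nonunital_algebra_M_op: "nonunital_algebra centre_ring M_op"
proof -
  interpret Mat: nonunital_algebra centre_ring "matrix_algebra m :: ('r, 'r ncpoly mat) module"
    by (rule nonunital_algebra_matrix)
  have "nonunital_algebra centre_ring ((matrix_algebra m)\<lparr>carrier := MX scale m k x\<rparr>)"
  proof (rule Mat.subalgebra)
    show "MX scale m k x \<subseteq> carrier (matrix_algebra m)"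
      by (auto simp: MX_def matrix_algebra_def)
    have "0\<^sub>m m m \<in> MX scale m k x"
    proof (rule MX_I)
      fix f :: "'r ncpoly mat" assume f: "f \<in> carrier_mat 1 m"
      show "\<Phi> (f * 0\<^sub>m m m) = 0"
        unfolding right_mult_zero_mat[OF f] by (rule Phi_zero)
    qed simp
    then show "\<zero>\<^bsub>matrix_algebra m\<^esub> \<in> MX scale m k x"
      by (simp add: matrix_algebra_def)
  next
    fix P Q assume P: "P \<in> MX scale m k x" and Q: "Q \<in> MX scale m k x"
    note PQ = MX_carrier[OF P] MX_carrier[OF Q]
    have "P + Q \<in> MX scale m k x"
    proof (rule MX_I)
      fix f assume f: "f \<in> carrier_mat 1 m" "\<Phi> f = 0"
      show "\<Phi> (f * (P + Q)) = 0"
        unfolding mult_add_distrib_mat[OF f(1) PQ]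
          Phi_add[OF row_mult_carrier[OF P f(1)] row_mult_carrier[OF Q f(1)]]
        using MX_D[OF P f] MX_D[OF Q f] by simp
    qed (use PQ in simp)
    then show "P \<oplus>\<^bsub>matrix_algebra m\<^esub> Q \<in> MX scale m k x"
      by (simp add: matrix_algebra_def)
    have "P * Q \<in> MX scale m k x"
    proof (rule MX_I)
      fix f assume f: "f \<in> carrier_mat 1 m" "\<Phi> f = 0"
      show "\<Phi> (f * (P * Q)) = 0"
        unfolding assoc_mult_mat[OF f(1) PQ, symmetric]
        by (rule MX_D[OF Q row_mult_carrier[OF P f(1)] MX_D[OF P f]])
    qed (use PQ in simp)
    then show "P \<otimes>\<^bsub>matrix_algebra m\<^esub> Q \<in> MX scale m k x"
      by (simp add: matrix_algebra_def)
  next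
    fix c P assume c: "c \<in> carrier (centre_ring :: 'r ring)" and P: "P \<in> MX scale m k x"
    have "Poly_Mapping.single 0 c \<cdot>\<^sub>m P \<in> MX scale m k x"
    proof (rule MX_I)
      fix f assume f: "f \<in> carrier_mat 1 m" "\<Phi> f = 0"
      show "\<Phi> (f * (Poly_Mapping.single 0 c \<cdot>\<^sub>m P)) = 0"
        unfolding const_smult_mult_mat[OF c f(1) MX_carrier[OF P]]
          Phi_const[OF row_mult_carrier[OF P f(1)]] MX_D[OF P f]
        by (rule scale_zero_right)
    qed (use MX_carrier[OF P] in simp)
    then show "c \<odot>\<^bsub>matrix_algebra m\<^esub> P \<in> MX scale m k x"
      by (simp add: matrix_algebra_def)
  qed
  then show ?thesis
    unfolding MX_algebra_def by (rule nonunital_algebra_opposite)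
qed

text \<open>
  Each case follows from the uniqueness of the induced endomorphism: the right-hand side lies in the
  centralizer and has the required values on the image of \<open>\<Phi>\<close>.
\<close>

lemma Lambda_hom: "algebra_hom centre_ring M_op Cen_alg \<Lambda>"
proof -
  interpret M: nonunital_algebra centre_ring M_op
    by (rule nonunital_algebra_M_op)
  interpret Cen: nonunital_algebra centre_ring Cen_alg
    by (rule nonunital_algebra_Cen[OF endo])
  have "\<Lambda> (P \<oplus>\<^bsub>M_op\<^esub> Q) = \<Lambda> P \<oplus>\<^bsub>Cen_alg\<^esub> \<Lambda> Q" if PQ: "P \<in> carrier M_op" "Q \<in> carrier M_op" for P Q
  proof (rule Lambda_eqI)
    show "\<Lambda> P \<oplus>\<^bsub>Cen_alg\<^esub> \<Lambda> Q \<in> Cen scale \<phi>"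
      using Cen.M.a_closed[of "\<Lambda> P" "\<Lambda> Q"] PQ Lambda_Cen by (simp add: Cen_simps(1) M_op_simps(1))
    show "(\<Lambda> P \<oplus>\<^bsub>Cen_alg\<^esub> \<Lambda> Q) (\<Phi> f) = \<Phi> (f * (P \<oplus>\<^bsub>M_op\<^esub> Q))" if "f \<in> carrier_mat 1 m" for f
      using that PQ MX_carrier[of P] MX_carrier[of Q] row_mult_carrier[of _ f]
      by (simp add: M_op_simps Cen_simps Lambda_Phi mult_add_distrib_mat Phi_add)
  qed
  moreover have "\<Lambda> (P \<otimes>\<^bsub>M_op\<^esub> Q) = \<Lambda> P \<otimes>\<^bsub>Cen_alg\<^esub> \<Lambda> Q" if PQ: "P \<in> carrier M_op" "Q \<in> carrier M_op" for P Q
  proof (rule Lambda_eqI)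
    show "\<Lambda> P \<otimes>\<^bsub>Cen_alg\<^esub> \<Lambda> Q \<in> Cen scale \<phi>"
      using Cen.mult_closed[of "\<Lambda> P" "\<Lambda> Q"] PQ Lambda_Cen by (simp add: Cen_simps(1) M_op_simps(1))
    show "(\<Lambda> P \<otimes>\<^bsub>Cen_alg\<^esub> \<Lambda> Q) (\<Phi> f) = \<Phi> (f * (P \<otimes>\<^bsub>M_op\<^esub> Q))" if f: "f \<in> carrier_mat 1 m" for f
    proof -
      have "(f * Q) * P = f * (Q * P)"
        using f PQ MX_carrier[of P] MX_carrier[of Q] by (simp add: M_op_simps)
      then show ?thesis
        using f PQ row_mult_carrier[of Q f] Lambda_Phi[of P "f * Q"] by (simp add: M_op_simps Cen_simps Lambda_Phi)
    qed
  qed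
  moreover have "\<Lambda> (c \<odot>\<^bsub>M_op\<^esub> P) = c \<odot>\<^bsub>Cen_alg\<^esub> \<Lambda> P"
    if cP: "c \<in> carrier centre_ring" "P \<in> carrier M_op" for c P
  proof (rule Lambda_eqI)
    show "c \<odot>\<^bsub>Cen_alg\<^esub> \<Lambda> P \<in> Cen scale \<phi>"
      using Cen.smult_closed[of c "\<Lambda> P"] cP Lambda_Cen by (simp add: Cen_simps(1) M_op_simps(1))
    show "(c \<odot>\<^bsub>Cen_alg\<^esub> \<Lambda> P) (\<Phi> f) = \<Phi> (f * (c \<odot>\<^bsub>M_op\<^esub> P))" if "f \<in> carrier_mat 1 m" for f
      using that cP MX_carrier[of P] row_mult_carrier[of P f]
      by (simp add: M_op_simps Cen_simps Lambda_Phi const_smult_mult_mat Phi_const)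
  qed
  ultimately show ?thesis
    using Lambda_Cen by (simp add: algebra_hom_def M_op_simps(1) Cen_simps(1))
qed

lemma Lambda_image: "\<Lambda> ` carrier M_op = carrier Cen_alg"
  using Lambda_Cen by (auto simp: M_op_simps Cen_simps elim: Lambda_surj)

lemma M0X_iff_Lambda_Cen0:
  assumes P: "P \<in> MX scale m k x"
  shows "P \<in> M0X scale m k x \<longleftrightarrow> \<Lambda> P \<in> Cen0 scale \<phi>"
proof -
  have "\<Phi> (polyvar \<cdot>\<^sub>m (f * P)) = \<phi> (\<Lambda> P (\<Phi> f))" if "f \<in> carrier_mat 1 m" for f
    using that MX_carrier[OF P] by (simp add: Lambda_Phi[OF P] Phi_polyvar)
  then have "P \<in> M0X scale m k x \<longleftrightarrow> (\<forall>f\<in>carrier_mat 1 m. \<phi> (\<Lambda> P (\<Phi> f)) = 0)"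
    using P MX_carrier[OF P] by (auto simp: M0X_def ker_Phi_def)
  also have "\<dots> \<longleftrightarrow> (\<forall>v. \<phi> (\<Lambda> P v) = 0)"
    by (metis Phi_surj)
  also have "\<dots> \<longleftrightarrow> \<Lambda> P \<in> Cen0 scale \<phi>"
    using Lambda_Cen[OF P] by (auto simp: Cen_def Cen0_def fun_eq_iff)
  finally show ?thesis .
qed

end

section \<open>The induced isomorphisms\<close>

context jordan_module
begin

lemma M0X_algebra_op: "opposite_algebra (M0X_algebra scale m k x) = M_op\<lparr>carrier := M0X scale m k x\<rparr>"
  by (simp add: opposite_algebra_def M0X_algebra_def MX_algebra_def)

lemma Cen0_algebra_eq: "Cen0_algebra scale \<phi> = Cen_alg\<lparr>carrier := Cen0 scale \<phi>\<rparr>"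
  by (simp add: Cen0_algebra_def Cen_algebra_def)

lemma M0X_subset: "M0X scale m k x \<subseteq> MX scale m k x"
  by (auto simp: M0X_def)

theorem MX_mod_M0X:
  "algebra_ideal centre_ring (M0X scale m k x) M_op"
  "\<exists>h. algebra_iso centre_ring (quotient_algebra M_op (M0X scale m k x))
         (quotient_algebra Cen_alg (Cen0 scale \<phi>)) h \<and>
       (\<forall>P\<in>carrier M_op. h (M0X scale m k x +>\<^bsub>M_op\<^esub> P) = Cen0 scale \<phi> +>\<^bsub>Cen_alg\<^esub> \<Lambda> P)"
proof -
  interpret Cen: nonunital_algebra centre_ring Cen_alg
    by (rule nonunital_algebra_Cen[OF endo])
  let ?Q = "quotient_algebra Cen_alg (Cen0 scale \<phi>)"
  let ?f = "(\<lambda>\<psi>. Cen0 scale \<phi> +>\<^bsub>Cen_alg\<^esub> \<psi>) \<circ> \<Lambda>"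
  note ideal = Cen0_ideal[OF endo]
  have Q: "nonunital_algebra centre_ring ?Q"
    by (rule Cen.nonunital_algebra_quotient[OF ideal])
  have hom: "algebra_hom centre_ring M_op ?Q ?f"
    by (rule algebra_hom_comp[OF Lambda_hom Cen.quotient_projection[OF ideal]])
  have surj: "?f ` carrier M_op = carrier ?Q"
    by (simp only: image_comp[symmetric] Lambda_image Cen.quotient_cosets)
  have "?f P = \<zero>\<^bsub>?Q\<^esub> \<longleftrightarrow> P \<in> M0X scale m k x" if "P \<in> MX scale m k x" for P
    using that Lambda_Cen[OF that] Cen.coset_eq_ideal_iff[OF ideal, of "\<Lambda> P"]
    by (simp add: quotient_algebra_def Cen_simps(1) M0X_iff_Lambda_Cen0)
  then have ker: "M0X scale m k x = {P \<in> carrier M_op. ?f P = \<zero>\<^bsub>?Q\<^esub>}"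
    using M0X_subset by (auto simp: M_op_simps(1))
  show "algebra_ideal centre_ring (M0X scale m k x) M_op"
    by (rule first_isomorphism(1)[OF nonunital_algebra_M_op Q hom surj ker])
  show "\<exists>h. algebra_iso centre_ring (quotient_algebra M_op (M0X scale m k x)) ?Q h \<and>
      (\<forall>P\<in>carrier M_op. h (M0X scale m k x +>\<^bsub>M_op\<^esub> P) = Cen0 scale \<phi> +>\<^bsub>Cen_alg\<^esub> \<Lambda> P)"
    using first_isomorphism(2)[OF nonunital_algebra_M_op Q hom surj ker] by simp
qed

theorem M0X_mod_ker_Lambda:
  fixes M0_op
  defines "M0_op \<equiv> opposite_algebra (M0X_algebra scale m k x)"
  shows "algebra_ideal centre_ring (ker_Lambda scale \<phi> m k x) M0_op"
    and "\<exists>h. algebra_iso centre_ring (quotient_algebra M0_op (ker_Lambda scale \<phi> m k x)) (Cen0_algebra scale \<phi>) h \<and>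
           (\<forall>P\<in>carrier M0_op. h (ker_Lambda scale \<phi> m k x +>\<^bsub>M0_op\<^esub> P) = \<Lambda> P)"
proof -
  interpret M: nonunital_algebra centre_ring M_op
    by (rule nonunital_algebra_M_op)
  interpret Cen: nonunital_algebra centre_ring Cen_alg
    by (rule nonunital_algebra_Cen[OF endo])
  have M0: "nonunital_algebra centre_ring M0_op"
    unfolding M0_op_def M0X_algebra_op by (rule M.ideal_subalgebra[OF MX_mod_M0X(1)])
  have C0: "nonunital_algebra centre_ring (Cen0_algebra scale \<phi>)"
    unfolding Cen0_algebra_eq by (rule Cen.ideal_subalgebra[OF Cen0_ideal[OF endo]])
  have hom: "algebra_hom centre_ring M0_op (Cen0_algebra scale \<phi>) \<Lambda>"
    unfolding M0_op_def M0X_algebra_op Cen0_algebra_eq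
    using M0X_subset M0X_iff_Lambda_Cen0
    by (intro algebra_hom_restrict[OF Lambda_hom]) (auto simp: M_op_simps(1))
  have "\<exists>P\<in>M0X scale m k x. \<Lambda> P = \<psi>" if "\<psi> \<in> Cen0 scale \<phi>" for \<psi>
  proof -
    have "\<psi> \<in> Cen scale \<phi>"
      using that by (auto simp: Cen_def Cen0_def)
    then obtain P where "P \<in> MX scale m k x" "\<Lambda> P = \<psi>"
      by (rule Lambda_surj)
    then show ?thesis
      using that M0X_iff_Lambda_Cen0 by blast
  qed
  then have surj: "\<Lambda> ` carrier M0_op = carrier (Cen0_algebra scale \<phi>)"
    using M0X_subset M0X_iff_Lambda_Cen0
    by (auto simp: M0_op_def M0X_algebra_op Cen0_algebra_eq)
  have "(\<lambda>_. 0) \<in> Cen0 scale \<phi>"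
    using endomorphism_zero[OF endo] by (auto simp: Cen0_def module_endomorphism_def scale_zero_right)
  then have ker: "ker_Lambda scale \<phi> m k x = {P \<in> carrier M0_op. \<Lambda> P = \<zero>\<^bsub>Cen0_algebra scale \<phi>\<^esub>}"
    using M0X_subset
    by (auto simp: ker_Lambda_def a_kernel_def' M0_op_def M0X_algebra_op Cen0_algebra_eq M_op_simps(1)
        Cen_simps(5) M0X_iff_Lambda_Cen0)
  show "algebra_ideal centre_ring (ker_Lambda scale \<phi> m k x) M0_op"
    by (rule first_isomorphism(1)[OF M0 C0 hom surj ker])
  show "\<exists>h. algebra_iso centre_ring (quotient_algebra M0_op (ker_Lambda scale \<phi> m k x)) (Cen0_algebra scale \<phi>) h \<and>
           (\<forall>P\<in>carrier M0_op. h (ker_Lambda scale \<phi> m k x +>\<^bsub>M0_op\<^esub> P) = \<Lambda> P)"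
    by (rule first_isomorphism(2)[OF M0 C0 hom surj ker])
qed

end

theorem theorem3p3:
  fixes scale :: "'r::{ring,monoid_mult} \<Rightarrow> 'm::ab_group_add \<Rightarrow> 'm"
    and \<phi> :: "'m \<Rightarrow> 'm"
    and m :: nat and k :: "nat \<Rightarrow> nat" and x :: "nat \<Rightarrow> nat \<Rightarrow> 'm"
  assumes "left_module scale"
    and "finitely_generated_module scale"
    and "semisimple_module scale"
    and "module_endomorphism scale \<phi>"
    and "nilpotent_map \<phi>"
    and "nilpotent_jordan_normal_base scale \<phi> {..<m} k x"
    and "\<forall>\<gamma> \<delta>. \<gamma> \<le> \<delta> \<and> \<delta> < m \<longrightarrow> k \<delta> \<le> k \<gamma>"
    and "\<forall>\<gamma><m. 1 \<le> k \<gamma>"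
  defines "Z \<equiv> centre_ring :: 'r ring"
    and "M_op \<equiv> opposite_algebra (MX_algebra scale m k x)"
    and "M0_op \<equiv> opposite_algebra (M0X_algebra scale m k x)"
    and "kerL \<equiv> ker_Lambda scale \<phi> m k x"
    and "CenA \<equiv> Cen_algebra scale \<phi>"
    and "Cen0A \<equiv> Cen0_algebra scale \<phi>"
    and "\<Lambda> \<equiv> Lambda scale \<phi> m k x"
  shows "(algebra_ideal Z kerL M0_op \<and>
          (\<exists>h. algebra_iso Z (quotient_algebra M0_op kerL) Cen0A h \<and>
               (\<forall>P\<in>carrier M0_op. h (kerL +>\<^bsub>M0_op\<^esub> P) = \<Lambda> P))) \<and>
         (algebra_ideal Z (carrier M0_op) M_op \<and> algebra_ideal Z (carrier Cen0A) CenA \<and>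
          (\<exists>h. algebra_iso Z (quotient_algebra M_op (carrier M0_op))
                 (quotient_algebra CenA (carrier Cen0A)) h \<and>
               (\<forall>P\<in>carrier M_op. h (carrier M0_op +>\<^bsub>M_op\<^esub> P) = carrier Cen0A +>\<^bsub>CenA\<^esub> \<Lambda> P)))"
proof -
  interpret J: jordan_module scale \<phi> m k x
    using assms(1,4,6) by (simp add: jordan_module_def jordan_module_axioms_def)
  have "carrier M0_op = M0X scale m k x" "carrier Cen0A = Cen0 scale \<phi>"
    by (simp_all add: M0_op_def Cen0A_def J.M0X_algebra_op J.Cen0_algebra_eq)
  then show ?thesis
    using J.M0X_mod_ker_Lambda J.MX_mod_M0X J.Cen0_ideal[OF assms(4)]
    unfolding Z_def M_op_def CenA_def \<Lambda>_def kerL_def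
    by (simp only: M0_op_def Cen0A_def)
qed

end
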